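(* Let $U$ be a graph. The following properties are equivalent: (1) There are two graphs $G$ and $G'$ (on the same vertex set) having the same $3$-element homogeneous subsets such that $U=G\dot{+}G'$. (2) $S(U)$ and $S(\overline U)$ are bipartite. (3) Either (i) $U$ is (up to isomorphism) an induced subgraph of $P_9$, or (ii) the connected components of $U$, or of its complement $\overline U$, are cycles of even length, paths or isolated vertices.
   Context: Graphs are undirected, simple and loopless: a graph is a pair $(V,\mathcal E)$ with $\mathcal E\subseteq [V]^2$, the set of $2$-element subsets of $V$. The complement of $G=(V,\mathcal E)$ is $\overline G=(V,[V]^2\setminus\mathcal E)$. The graph induced by $G$ on $A\subseteq V$ is $(A,\mathcal E\cap [A]^2)$. A subset of vertices of a graph is homogeneous if it is a clique or an independent set. The Boolean sum $G\dot{+}G'$ of two graphs $G$ and $G'$ on the same vertex set $V$ is the graph on $V$ whose edge set is the symmetric difference $E(G)\,\Delta\, E(G')$. The edge-graph $S(U)$ of a graph $U$ is the graph whose vertices are the edges of $U$ and whose edges are the unordered pairs $\{u,v\}$ such that $u=\{x,y\}$, $v=\{x,z\}$ for three distinct vertices $x,y,z$ of $U$ such that $\{y,z\}$ is not an edge of $U$. $P_9$ is the Paley graph on $9$ vertices, isomorphic to the cartesian product $K_3\Box K_3$ (where $K_3$ is the complete graph on $3$ vertices): its vertices are the pairs $(i,j)$ with $i,j\in\{0,1,2\}$, two distinct pairs being adjacent iff they agree in exactly one coordinate. *)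

theory Defs
  imports Main "HOL-Library.Ramsey"
begin

text \<open>
  A graph is a pair of a vertex set \<open>V\<close> and an edge set, a set of 2-element subsets of \<open>V\<close>.
  The vertex set is not assumed to be finite.
\<close>

type_synonym 'a graph = "'a set \<times> 'a set set"

abbreviation verts :: "'a graph \<Rightarrow> 'a set" where
  "verts G \<equiv> fst G"

abbreviation edges :: "'a graph \<Rightarrow> 'a set set" where
  "edges G \<equiv> snd G"

definition is_graph :: "'a graph \<Rightarrow> bool" where
  "is_graph G \<longleftrightarrow> edges G \<subseteq> [verts G]\<^bsup>2\<^esup>"

definition complement_graph :: "'a graph \<Rightarrow> 'a graph" where
  "complement_graph G = (verts G, [verts G]\<^bsup>2\<^esup> - edges G)"

definition induced_graph :: "'a graph \<Rightarrow> 'a set \<Rightarrow> 'a graph" where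
  "induced_graph G A = (A, edges G \<inter> [A]\<^bsup>2\<^esup>)"

definition boolean_sum :: "'a graph \<Rightarrow> 'a graph \<Rightarrow> 'a graph" where
  "boolean_sum G G' = (verts G, sym_diff (edges G) (edges G'))"

definition homogeneous :: "'a graph \<Rightarrow> 'a set \<Rightarrow> bool" where
  "homogeneous G A \<longleftrightarrow> A \<subseteq> verts G \<and> (clique A (edges G) \<or> indep A (edges G))"

definition homogeneous_triples :: "'a graph \<Rightarrow> 'a set set" where
  "homogeneous_triples G = {T \<in> [verts G]\<^bsup>3\<^esup>. homogeneous G T}"

definition edge_graph :: "'a graph \<Rightarrow> 'a set graph" where
  "edge_graph U =
    (edges U,
     {{{x, y}, {x, z}} | x y z. distinct [x, y, z] \<and>
        {x, y} \<in> edges U \<and> {x, z} \<in> edges U \<and> {y, z} \<notin> edges U})"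

text \<open>Either side of the bipartition may be empty.\<close>

definition bipartite :: "'a graph \<Rightarrow> bool" where
  "bipartite G \<longleftrightarrow>
    (\<exists>A B. A \<union> B = verts G \<and> A \<inter> B = {} \<and> indep A (edges G) \<and> indep B (edges G))"

definition isomorphic :: "'a graph \<Rightarrow> 'b graph \<Rightarrow> bool" where
  "isomorphic G H \<longleftrightarrow>
    (\<exists>f. bij_betw f (verts G) (verts H) \<and>
         (\<forall>x\<in>verts G. \<forall>y\<in>verts G. {x, y} \<in> edges G \<longleftrightarrow> {f x, f y} \<in> edges H))"

definition P9 :: "(nat \<times> nat) graph" where
  "P9 = ({0, 1, 2} \<times> {0, 1, 2},
     {{(i, j), (i', j')} | i j i' j'.
        {i, j, i', j'} \<subseteq> {0, 1, 2} \<and> ((i = i') \<noteq> (j = j'))})"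

definition connectivity :: "'a graph \<Rightarrow> ('a \<times> 'a) set" where
  "connectivity G =
    {(x, y). x \<in> verts G \<and> y \<in> verts G \<and> (x, y) \<in> {(u, v). {u, v} \<in> edges G}\<^sup>*}"

definition components :: "'a graph \<Rightarrow> 'a graph set" where
  "components G = induced_graph G ` (verts G // connectivity G)"

definition cycle_graph :: "nat \<Rightarrow> nat graph" where
  "cycle_graph n = ({..<n}, {{i, Suc i mod n} | i. i < n})"

definition even_cycle :: "'a graph \<Rightarrow> bool" where
  "even_cycle C \<longleftrightarrow> (\<exists>n\<ge>3. even n \<and> isomorphic C (cycle_graph n))"

text \<open>
  A path is a copy of a nonempty interval of the integers, so it may be finite, infinite in one
  direction, or infinite in both. For finite graphs this is the usual notion. The infinite paths
  are needed because graphs may be infinite: the two-way infinite path \<open>U\<close> is bipartite, and both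
  \<open>edge_graph U\<close> and \<open>edge_graph (complement_graph U)\<close> are bipartite.
\<close>

definition path_graph :: "int set \<Rightarrow> int graph" where
  "path_graph I = (I, {{i, i + 1} | i. i \<in> I \<and> i + 1 \<in> I})"

definition is_path :: "'a graph \<Rightarrow> bool" where
  "is_path C \<longleftrightarrow>
    (\<exists>I. I \<noteq> {} \<and> (\<forall>a\<in>I. \<forall>b\<in>I. {a..b} \<subseteq> I) \<and> isomorphic C (path_graph I))"

definition isolated_vertex :: "'a graph \<Rightarrow> bool" where
  "isolated_vertex C \<longleftrightarrow> (\<exists>v. C = ({v}, {}))"

definition even_cycles_or_paths :: "'a graph \<Rightarrow> bool" where
  "even_cycles_or_paths G \<longleftrightarrow>
    (\<forall>C\<in>components G. even_cycle C \<or> is_path C \<or> isolated_vertex C)"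

end

theory Submission
  imports Defs
begin

text \<open>
  Membership in \<open>G\<close> 2-colours the edges and the non-edges of \<open>U\<close>; the condition on homogeneous
  triples says exactly that these colourings are proper for the two edge-graphs.

  If the edge-graphs are bipartite, then \<open>U\<close> contains neither a claw, nor a 3-sun, nor the complement of
  either. If \<open>U\<close> has a triangle and a stable triple, this excludes diamonds and \<open>K\<^sub>4\<close>, so every vertex
  outside a triangle has a unique neighbour in it and every vertex outside a stable triple has exactly
  two neighbours in it; this forces \<open>U\<close> into the grid \<open>K\<^sub>3 \<box> K\<^sub>3\<close>. If \<open>U\<close> is triangle-free, the
  bipartition is a proper 2-edge-colouring, and the walk that follows edges of alternating colours
  parametrises a component as a path or an even cycle; if \<open>U\<close> has no stable triple, the same holds
  for the complement.

  Conversely, on even cycles and paths the edges alternate in colour, and non-edges are coloured by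
  whether both ends lie on the same side of a 2-colouring of the vertices.
\<close>

subsection \<open>Graphs with the same homogeneous triples\<close>

lemma pair_in_nsets_iff: "{x, y} \<in> [A]\<^bsup>2\<^esup> \<longleftrightarrow> x \<in> A \<and> y \<in> A \<and> x \<noteq> y"
  by (auto simp: nsets_def card_2_iff doubleton_eq_iff)

lemma edges_pairD:
  assumes "is_graph U" "{x, y} \<in> edges U"
  shows "x \<in> verts U" "y \<in> verts U" "x \<noteq> y"
  using assms by (auto simp: is_graph_def nsets_def card_2_iff doubleton_eq_iff subset_iff)

lemma verts_complement [simp]: "verts (complement_graph U) = verts U"
  by (simp add: complement_graph_def)

lemma pair_in_complement_iff:
  "{x, y} \<in> edges (complement_graph U) \<longleftrightarrow>
     x \<in> verts U \<and> y \<in> verts U \<and> x \<noteq> y \<and> {x, y} \<notin> edges U"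
  by (auto simp: complement_graph_def nsets_def card_2_iff doubleton_eq_iff)

lemma is_graph_complement: "is_graph (complement_graph U)"
  by (auto simp: complement_graph_def is_graph_def)

lemma complement_complement:
  assumes "is_graph U"
  shows "complement_graph (complement_graph U) = U"
  using assms by (auto simp: complement_graph_def is_graph_def prod_eq_iff)

text \<open>Encoding the two sides by one predicate \<open>c\<close> replaces the edge-graph by a
  local condition at a vertex \<open>x\<close>; only the values of \<open>c\<close> on
  \<open>edges U\<close> matter.\<close>

lemma bipartite_edge_graph_iff:
  assumes "is_graph U"
  shows "bipartite (edge_graph U) \<longleftrightarrow>
    (\<exists>c :: 'a set \<Rightarrow> bool. \<forall>x y z. y \<noteq> z \<longrightarrow> {x, y} \<in> edges U \<longrightarrow> {x, z} \<in> edges U \<longrightarrow>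
       {y, z} \<notin> edges U \<longrightarrow> c {x, y} \<noteq> c {x, z})"
    (is "_ \<longleftrightarrow> ?R")
proof
  assume "bipartite (edge_graph U)"
  then obtain A B where AB: "A \<union> B = edges U" "A \<inter> B = {}"
    "indep A (edges (edge_graph U))" "indep B (edges (edge_graph U))"
    by (auto simp: bipartite_def edge_graph_def)
  have "({x, y} \<in> A) \<noteq> ({x, z} \<in> A)"
    if h: "y \<noteq> z" "{x, y} \<in> edges U" "{x, z} \<in> edges U" "{y, z} \<notin> edges U" for x y z
  proof -
    have "distinct [x, y, z]"
      using h edges_pairD(3)[OF assms] by auto
    then have "{{x, y}, {x, z}} \<in> edges (edge_graph U)"
      using h unfolding edge_graph_def by auto
    \<comment> \<open>\<open>indep\<close> speaks of distinct elements only.\<close>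
    moreover have "{x, y} \<noteq> {x, z}"
      using h by (auto simp: doubleton_eq_iff)
    ultimately have "\<not> ({x, y} \<in> S \<and> {x, z} \<in> S)" if "indep S (edges (edge_graph U))" for S
      using that unfolding indep_def by metis
    from this[OF AB(3)] this[OF AB(4)]
    have "\<not> ({x, y} \<in> A \<and> {x, z} \<in> A)" "\<not> ({x, y} \<in> B \<and> {x, z} \<in> B)" .
    then show ?thesis
      using AB(1) h by blast
  qed
  then show ?R
    by (intro exI[of _ "\<lambda>e. e \<in> A"]) blast
next
  assume ?R
  then obtain c :: "'a set \<Rightarrow> bool" where
    c: "\<And>x y z. y \<noteq> z \<Longrightarrow> {x, y} \<in> edges U \<Longrightarrow> {x, z} \<in> edges U \<Longrightarrow>
       {y, z} \<notin> edges U \<Longrightarrow> c {x, y} \<noteq> c {x, z}"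
    by blast
  have "c e \<noteq> c e'" if "{e, e'} \<in> edges (edge_graph U)" for e e'
  proof -
    obtain x y z where "{e, e'} = {{x, y}, {x, z}}" "distinct [x, y, z]"
      "{x, y} \<in> edges U" "{x, z} \<in> edges U" "{y, z} \<notin> edges U"
      using \<open>{e, e'} \<in> _\<close> unfolding edge_graph_def by auto
    moreover from this(1) have "e = {x, y} \<and> e' = {x, z} \<or> e = {x, z} \<and> e' = {x, y}"
      unfolding doubleton_eq_iff[of e e'] .
    moreover have "c {x, y} \<noteq> c {x, z}"
      using calculation by (intro c) auto
    ultimately show ?thesis
      by metis
  qed
  then have "indep {e \<in> edges U. c e = b} (edges (edge_graph U))" for b
    unfolding indep_def by blast
  from this[of True] this[of False] show "bipartite (edge_graph U)"
    unfolding bipartite_def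
    by (intro exI[of _ "{e \<in> edges U. c e}"] exI[of _ "{e \<in> edges U. \<not> c e}"])
      (auto simp: edge_graph_def)
qed

lemma pair_in_boolean_sum_iff:
  "{x, y} \<in> edges (boolean_sum G G') \<longleftrightarrow> ({x, y} \<in> edges G) \<noteq> ({x, y} \<in> edges G')"
  by (auto simp: boolean_sum_def)

text \<open>In this form, comparing two graphs on a triple is propositional in the membership of
  three pairs.\<close>

lemma triple_homogeneous_iff:
  assumes "distinct [x, y, z]" "x \<in> verts G" "y \<in> verts G" "z \<in> verts G"
  shows "{x, y, z} \<in> homogeneous_triples G \<longleftrightarrow>
    ({x, y} \<in> edges G \<longleftrightarrow> {x, z} \<in> edges G) \<and> ({x, y} \<in> edges G \<longleftrightarrow> {y, z} \<in> edges G)"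
proof -
  have [simp]: "{y, x} = {x, y}" "{z, x} = {x, z}" "{z, y} = {y, z}"
    by auto
  have "clique {x, y, z} (edges G) \<longleftrightarrow> {x, y} \<in> edges G \<and> {x, z} \<in> edges G \<and> {y, z} \<in> edges G"
    "indep {x, y, z} (edges G) \<longleftrightarrow> {x, y} \<notin> edges G \<and> {x, z} \<notin> edges G \<and> {y, z} \<notin> edges G"
    using assms(1) by (simp_all add: clique_def indep_def) metis+
  moreover have "{x, y, z} \<in> [verts G]\<^bsup>3\<^esup>"
    using assms by (auto simp: nsets_def)
  ultimately show ?thesis
    using assms by (auto simp: homogeneous_triples_def homogeneous_def)
qed

lemma homogeneous_tripleE:
  assumes "T \<in> homogeneous_triples G"
  obtains x y z where "T = {x, y, z}" "distinct [x, y, z]" "x \<in> verts G" "y \<in> verts G" "z \<in> verts G"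
  using assms by (auto simp: homogeneous_triples_def nsets_def card_3_iff)

text \<open>Membership in \<open>G\<close> colours both edge-graphs. Let \<open>{x, y}\<close> and
  \<open>{x, z}\<close> have the same status in \<open>G\<close>. If they are edges of
  \<open>U\<close> and \<open>{y, z}\<close> is not, then in \<open>G'\<close> exactly these two
  flip; in the dual situation only \<open>{y, z}\<close> flips. Either way the triple is homogeneous
  in exactly one of the two graphs.\<close>

lemma homogeneous_triples_imp_bipartite:
  assumes G: "is_graph G" "is_graph G'" "verts G = verts G'"
    and hom: "homogeneous_triples G = homogeneous_triples G'"
    and U: "U = boolean_sum G G'" "is_graph U"
  shows "bipartite (edge_graph U) \<and> bipartite (edge_graph (complement_graph U))"
proof -
  have V: "verts U = verts G"
    by (simp add: U boolean_sum_def)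
  have E: "{x, y} \<in> edges U \<longleftrightarrow> ({x, y} \<in> edges G) \<noteq> ({x, y} \<in> edges G')" for x y
    by (simp add: U pair_in_boolean_sum_iff)
  have hom': "{x, y, z} \<in> homogeneous_triples G \<longleftrightarrow> {x, y, z} \<in> homogeneous_triples G'" for x y z
    by (simp add: hom)
  have T: "(({x, y} \<in> edges G \<longleftrightarrow> {x, z} \<in> edges G) \<and> ({x, y} \<in> edges G \<longleftrightarrow> {y, z} \<in> edges G)) \<longleftrightarrow>
    (({x, y} \<in> edges G' \<longleftrightarrow> {x, z} \<in> edges G') \<and> ({x, y} \<in> edges G' \<longleftrightarrow> {y, z} \<in> edges G'))"
    if "distinct [x, y, z]" "x \<in> verts G" "y \<in> verts G" "z \<in> verts G" for x y z
    using triple_homogeneous_iff[of x y z G] triple_homogeneous_iff[of x y z G'] hom'[of x y z] that G(3)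
    by simp
  have "({x, y} \<in> edges G) \<noteq> ({x, z} \<in> edges G)"
    if h: "y \<noteq> z" "{x, y} \<in> edges U" "{x, z} \<in> edges U" "{y, z} \<notin> edges U" for x y z
    using T[of x y z] h edges_pairD[OF U(2)] V E by auto
  moreover have "({x, y} \<in> edges G) \<noteq> ({x, z} \<in> edges G)"
    if h: "y \<noteq> z" "{x, y} \<in> edges (complement_graph U)" "{x, z} \<in> edges (complement_graph U)"
      "{y, z} \<notin> edges (complement_graph U)" for x y z
    using T[of x y z] h V E unfolding pair_in_complement_iff by auto
  ultimately show ?thesis
    unfolding bipartite_edge_graph_iff[OF U(2)] bipartite_edge_graph_iff[OF is_graph_complement]
    by (intro conjI exI[of _ "\<lambda>e. e \<in> edges G"]) blast+
qed

text \<open>\<open>c\<close> distributes the edges of \<open>U\<close> over \<open>G\<close> and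
  \<open>G'\<close>, and \<open>d\<close> selects the non-edges put into both. On a triple without
  edges of \<open>U\<close> the two graphs agree, on one with three edges they are complementary,
  and otherwise \<open>c\<close> or \<open>d\<close> separates two pairs, so the triple is
  homogeneous in neither.\<close>

lemma bipartite_imp_homogeneous_triples:
  assumes U: "is_graph U"
    and bip: "bipartite (edge_graph U)" "bipartite (edge_graph (complement_graph U))"
  shows "\<exists>G G'. is_graph G \<and> is_graph G' \<and> verts G = verts G' \<and>
    homogeneous_triples G = homogeneous_triples G' \<and> U = boolean_sum G G'"
proof -
  obtain c :: "'a set \<Rightarrow> bool" where
    c: "\<And>x y z. y \<noteq> z \<Longrightarrow> {x, y} \<in> edges U \<Longrightarrow> {x, z} \<in> edges U \<Longrightarrow>
       {y, z} \<notin> edges U \<Longrightarrow> c {x, y} \<noteq> c {x, z}"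
    using bip(1) unfolding bipartite_edge_graph_iff[OF U] by blast
  obtain d :: "'a set \<Rightarrow> bool" where
    "\<And>x y z. y \<noteq> z \<Longrightarrow> {x, y} \<in> edges (complement_graph U) \<Longrightarrow> {x, z} \<in> edges (complement_graph U) \<Longrightarrow>
       {y, z} \<notin> edges (complement_graph U) \<Longrightarrow> d {x, y} \<noteq> d {x, z}"
    using bip(2) unfolding bipartite_edge_graph_iff[OF is_graph_complement] by blast
  then have d: "d {x, y} \<noteq> d {x, z}"
    if "x \<in> verts U" "y \<in> verts U" "z \<in> verts U" "distinct [x, y, z]"
      "{x, y} \<notin> edges U" "{x, z} \<notin> edges U" "{y, z} \<in> edges U" for x y z
    using that by (auto simp: pair_in_complement_iff)
  define D where "D = {e \<in> edges (complement_graph U). d e}"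
  define G where "G = (verts U, {e \<in> edges U. c e} \<union> D)"
  define G' where "G' = (verts U, {e \<in> edges U. \<not> c e} \<union> D)"
  have disj: "D \<inter> edges U = {}"
    by (auto simp: D_def complement_graph_def)
  have graphs: "is_graph G" "is_graph G'"
    using U by (auto simp: is_graph_def G_def G'_def D_def complement_graph_def)
  have sum: "U = boolean_sum G G'"
    using disj by (auto simp: boolean_sum_def G_def G'_def prod_eq_iff)
  have V: "verts G = verts U" "verts G' = verts U"
    by (simp_all add: G_def G'_def)
  have eG: "{x, y} \<in> edges G \<longleftrightarrow> (if {x, y} \<in> edges U then c {x, y} else d {x, y})"
    and eG': "{x, y} \<in> edges G' \<longleftrightarrow> (if {x, y} \<in> edges U then \<not> c {x, y} else d {x, y})"
    if "x \<in> verts U" "y \<in> verts U" "x \<noteq> y" for x y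
    using that by (auto simp: G_def G'_def D_def pair_in_complement_iff)
  have triples: "{x, y, z} \<in> homogeneous_triples G \<longleftrightarrow> {x, y, z} \<in> homogeneous_triples G'"
    if h: "distinct [x, y, z]" "x \<in> verts U" "y \<in> verts U" "z \<in> verts U" for x y z
  proof -
    have [simp]: "{y, x} = {x, y}" "{z, x} = {x, z}" "{z, y} = {y, z}"
      by auto
    note e = eG[OF h(2,3)] eG[OF h(2,4)] eG[OF h(3,4)] eG'[OF h(2,3)] eG'[OF h(2,4)] eG'[OF h(3,4)]
    have hG: "{x, y, z} \<in> homogeneous_triples G \<longleftrightarrow>
        ({x, y} \<in> edges G \<longleftrightarrow> {x, z} \<in> edges G) \<and> ({x, y} \<in> edges G \<longleftrightarrow> {y, z} \<in> edges G)"
      and hG': "{x, y, z} \<in> homogeneous_triples G' \<longleftrightarrow>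
        ({x, y} \<in> edges G' \<longleftrightarrow> {x, z} \<in> edges G') \<and> ({x, y} \<in> edges G' \<longleftrightarrow> {y, z} \<in> edges G')"
      using h V by (simp_all add: triple_homogeneous_iff)
    have ne: "y \<noteq> x" "z \<noteq> x" "z \<noteq> y"
      using h(1) by auto
    have c': "{x, y} \<in> edges U \<Longrightarrow> {x, z} \<in> edges U \<Longrightarrow> {y, z} \<notin> edges U \<Longrightarrow> c {x, y} \<noteq> c {x, z}"
      "{x, y} \<in> edges U \<Longrightarrow> {y, z} \<in> edges U \<Longrightarrow> {x, z} \<notin> edges U \<Longrightarrow> c {x, y} \<noteq> c {y, z}"
      "{x, z} \<in> edges U \<Longrightarrow> {y, z} \<in> edges U \<Longrightarrow> {x, y} \<notin> edges U \<Longrightarrow> c {x, z} \<noteq> c {y, z}"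
      using c[of y z x] c[of x z y] c[of x y z] h by simp_all
    have d': "{x, y} \<notin> edges U \<Longrightarrow> {x, z} \<notin> edges U \<Longrightarrow> {y, z} \<in> edges U \<Longrightarrow> d {x, y} \<noteq> d {x, z}"
      "{x, y} \<notin> edges U \<Longrightarrow> {y, z} \<notin> edges U \<Longrightarrow> {x, z} \<in> edges U \<Longrightarrow> d {x, y} \<noteq> d {y, z}"
      "{x, z} \<notin> edges U \<Longrightarrow> {y, z} \<notin> edges U \<Longrightarrow> {x, y} \<in> edges U \<Longrightarrow> d {x, z} \<noteq> d {y, z}"
      using d[of x y z] d[of y x z] d[of z x y] h ne by simp_all
    show ?thesis
      unfolding hG hG' using c' d' e h(1)
      by (cases "{x, y} \<in> edges U"; cases "{x, z} \<in> edges U"; cases "{y, z} \<in> edges U") auto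
  qed
  have "T \<in> homogeneous_triples G \<longleftrightarrow> T \<in> homogeneous_triples G'" for T
  proof (cases "\<exists>x y z. T = {x, y, z} \<and> distinct [x, y, z] \<and> {x, y, z} \<subseteq> verts U")
    case True
    then show ?thesis
      using triples by auto
  next
    case False
    then have "T \<notin> homogeneous_triples H" if "verts H = verts U" for H
      using homogeneous_tripleE[of T H] that by (metis empty_subsetI insert_subset)
    then show ?thesis
      using V by blast
  qed
  then have "homogeneous_triples G = homogeneous_triples G'"
    by blast
  moreover have "verts G = verts G'"
    using V by simp
  ultimately show ?thesis
    using graphs sum by blast
qed

subsection \<open>Graphs with a triangle and a stable triple\<close>

text \<open>\<open>c\<close> and \<open>d\<close> are bipartitions of the edge-graph and of the edge-graph of the complement,
  so complementing \<open>E\<close> and exchanging them gives another instance of the locale.\<close>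

locale two_coloured_graph =
  fixes V :: "'a set" and E c d :: "'a \<Rightarrow> 'a \<Rightarrow> bool"
  assumes E_sym: "E x y \<Longrightarrow> E y x"
    and E_irrefl: "\<not> E x x"
    and c_sym: "c x y \<Longrightarrow> c y x"
    and d_sym: "d x y \<Longrightarrow> d y x"
    and c_edges: "x \<in> V \<Longrightarrow> y \<in> V \<Longrightarrow> z \<in> V \<Longrightarrow> y \<noteq> z \<Longrightarrow> E x y \<Longrightarrow> E x z \<Longrightarrow> \<not> E y z \<Longrightarrow> c x y \<noteq> c x z"
    and d_nonedges: "x \<in> V \<Longrightarrow> y \<in> V \<Longrightarrow> z \<in> V \<Longrightarrow> x \<noteq> y \<Longrightarrow> x \<noteq> z \<Longrightarrow> \<not> E x y \<Longrightarrow> \<not> E x z \<Longrightarrow> E y z \<Longrightarrow>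
      d x y \<noteq> d x z"
begin

lemma complement: "two_coloured_graph V (\<lambda>x y. x \<noteq> y \<and> \<not> E x y) d c"
  using E_sym E_irrefl c_sym d_sym c_edges d_nonedges by unfold_locales metis+

section \<open>Claws, co-claws and 3-suns\<close>

definition triangle :: "'a \<Rightarrow> 'a \<Rightarrow> 'a \<Rightarrow> bool" where
  "triangle x y z \<longleftrightarrow> x \<in> V \<and> y \<in> V \<and> z \<in> V \<and> E x y \<and> E x z \<and> E y z"

text \<open>Non-adjacency, unlike adjacency, does not force vertices to differ, hence the explicit
  inequalities.\<close>

definition stable :: "'a \<Rightarrow> 'a \<Rightarrow> 'a \<Rightarrow> bool" where
  "stable x y z \<longleftrightarrow> x \<in> V \<and> y \<in> V \<and> z \<in> V \<and> x \<noteq> y \<and> x \<noteq> z \<and> y \<noteq> z \<and> \<not> E x y \<and> \<not> E x z \<and> \<not> E y z"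

lemma E_commute: "E x y \<longleftrightarrow> E y x"
  using E_sym by blast

text \<open>The three edges of a claw would need three pairwise different values of
  \<open>c\<close>.\<close>

lemma claw_free: "stable x y z \<Longrightarrow> p \<in> V \<Longrightarrow> \<not> (E p x \<and> E p y \<and> E p z)"
  using c_edges[of p x y] c_edges[of p x z] c_edges[of p y z] by (auto simp: stable_def)

text \<open>Dually, the three non-edges from \<open>p\<close> to the triangle would need three
  pairwise different values of \<open>d\<close>.\<close>

lemma coclaw_free: "triangle x y z \<Longrightarrow> p \<in> V \<Longrightarrow> p \<noteq> x \<Longrightarrow> p \<noteq> y \<Longrightarrow> p \<noteq> z \<Longrightarrow> E p x \<or> E p y \<or> E p z"
  using d_nonedges[of p x y] d_nonedges[of p x z] d_nonedges[of p y z] by (auto simp: triangle_def)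

text \<open>The edge-graph of the 3-sun contains a cycle through all its nine vertices.\<close>

lemma sun_free:
  assumes "triangle a b e" "stable x y z"
    and "E x a" "E x b" "\<not> E x e" "E y a" "E y e" "\<not> E y b" "E z b" "E z e" "\<not> E z a"
  shows False
proof -
  note E = assms[unfolded triangle_def stable_def]
  have E': "E a x" "E b x" "\<not> E e x" "E a y" "E e y" "\<not> E b y" "E b z" "E e z" "\<not> E a z"
    "E b a" "E e a" "E e b" "\<not> E y x" "\<not> E z x" "\<not> E z y"
    using E E_sym by blast+
  have ne: "a \<noteq> z" "z \<noteq> a" "b \<noteq> y" "y \<noteq> b" "e \<noteq> x" "x \<noteq> e"
    using E E' by auto
  have ne': "y \<noteq> x" "z \<noteq> x" "z \<noteq> y"
    using E by auto
  \<comment> \<open>These inequalities run once around the edges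
    \<open>ab, ay, ax, ae, ez, ey, eb, bx, bz\<close> and back to \<open>ba\<close>, a cycle of odd
    length nine.\<close>
  have "c a b \<noteq> c a y" "c a y \<noteq> c a x" "c a x \<noteq> c a e" "c e a \<noteq> c e z" "c e z \<noteq> c e y"
    "c e y \<noteq> c e b" "c b e \<noteq> c b x" "c b x \<noteq> c b z" "c b z \<noteq> c b a"
    using c_edges[of a b y] c_edges[of a y x] c_edges[of a x e] c_edges[of e a z] c_edges[of e z y]
      c_edges[of e y b] c_edges[of b e x] c_edges[of b x z] c_edges[of b z a] E E' ne ne'
    by simp_all
  then show False
    using c_sym by metis
qed

section \<open>Diamonds and complete graphs on four vertices beside a stable triple\<close>

lemma triangle_perm: "triangle x y z \<Longrightarrow> triangle y x z" "triangle x y z \<Longrightarrow> triangle x z y"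
  "stable x y z \<Longrightarrow> stable y x z" "stable x y z \<Longrightarrow> stable x z y"
  using E_sym by (auto simp: triangle_def stable_def)

text \<open>By \<open>coclaw_free\<close>, \<open>p\<close> has a neighbour in each of the two
  triangles. If it missed both \<open>u\<close> and \<open>v\<close>, this neighbour would be
  \<open>a\<close> or \<open>b\<close>, the centre of a claw with ends \<open>u\<close>,
  \<open>v\<close>, \<open>p\<close>.\<close>

lemma diamond_outside:
  assumes "triangle a b u" "triangle a b v" "u \<noteq> v" "\<not> E u v"
    and p: "p \<in> V" "p \<notin> {a, b, u, v}"
  shows "E p u \<or> E p v"
    and "\<not> E p u \<Longrightarrow> E p a \<or> E p b"
    and "\<not> E p v \<Longrightarrow> E p a \<or> E p b"
proof -
  have 1: "E p a \<or> E p b \<or> E p u" "E p a \<or> E p b \<or> E p v"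
    using coclaw_free[OF assms(1) p(1)] coclaw_free[OF assms(2) p(1)] p(2) by auto
  then show "\<not> E p u \<Longrightarrow> E p a \<or> E p b" "\<not> E p v \<Longrightarrow> E p a \<or> E p b"
    by auto
  show "E p u \<or> E p v"
  proof (rule ccontr)
    assume "\<not> (E p u \<or> E p v)"
    then have "stable u v p"
      using assms E_commute by (auto simp: stable_def triangle_def)
    moreover have "E a p \<or> E b p"
      using 1 \<open>\<not> (E p u \<or> E p v)\<close> E_commute by blast
    ultimately show False
      using claw_free[of u v p a] claw_free[of u v p b] assms by (auto simp: triangle_def)
  qed
qed

text \<open>A stable triple containing a vertex of degree two of the diamond extends the diamond to a 3-sun.\<close>

lemma diamond_stable_end:
  assumes D: "triangle a b u" "triangle a b v" "u \<noteq> v" "\<not> E u v"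
    and S: "stable u p q"
  shows False
proof -
  note T = D(1,2)[unfolded triangle_def] S[unfolded stable_def]
  have nu: "\<not> E p u" "\<not> E q u"
    using T E_commute by blast+
  have out: "p \<notin> {a, b, u}" "q \<notin> {a, b, u}"
    using T nu E_irrefl E_commute by auto
  \<comment> \<open>If \<open>p\<close> were \<open>v\<close>, then \<open>q\<close>, which misses
    \<open>u\<close>, would have to be adjacent to \<open>v\<close>, that is to
    \<open>p\<close>.\<close>
  have "p \<noteq> v" "q \<noteq> v"
    using diamond_outside(1)[OF D, of q] diamond_outside(1)[OF D, of p] nu T out E_commute
    by (metis insert_iff singletonD)+
  then have pq: "E p v" "E q v" "E p a \<or> E p b" "E q a \<or> E q b"
    using diamond_outside[OF D, of p] diamond_outside[OF D, of q] nu T out by blast+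
  have "\<not> (E p a \<and> E q a)" "\<not> (E p b \<and> E q b)"
    using claw_free[OF S, of a] claw_free[OF S, of b] T E_commute by blast+
  \<comment> \<open>So \<open>u\<close>, \<open>p\<close>, \<open>q\<close> sit on the three
    different sides of the triangle \<open>a b v\<close>: a 3-sun.\<close>
  with pq consider "E p a" "\<not> E p b" "E q b" "\<not> E q a" | "E q a" "\<not> E q b" "E p b" "\<not> E p a"
    by blast
  then show False
  proof cases
    case 1
    show False
      by (rule sun_free[OF D(2) S]) (use 1 pq T D E_commute in blast)+
  next
    case 2
    show False
      by (rule sun_free[OF D(2) triangle_perm(4)[OF S]]) (use 2 pq T D E_commute in blast)+
  qed
qed

text \<open>By \<open>diamond_outside\<close>, each of \<open>p\<close> and \<open>q\<close> is
  adjacent to at least two of \<open>b\<close>, \<open>u\<close>, \<open>v\<close>. They share one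
  of these, which is the centre of a claw with ends \<open>a\<close>, \<open>p\<close>,
  \<open>q\<close>.\<close>

lemma diamond_stable_centre:
  assumes D: "triangle a b u" "triangle a b v" "u \<noteq> v" "\<not> E u v"
    and S: "stable a p q"
  shows False
proof -
  note T = D(1,2)[unfolded triangle_def] S[unfolded stable_def]
  have na: "\<not> E p a" "\<not> E q a"
    using T E_commute by blast+
  have out: "p \<notin> {a, b, u, v}" "q \<notin> {a, b, u, v}"
    using T na E_irrefl E_commute by auto
  have "\<not> (E p b \<and> E q b)" "\<not> (E p u \<and> E q u)" "\<not> (E p v \<and> E q v)"
    using claw_free[OF S, of b] claw_free[OF S, of u] claw_free[OF S, of v] T E_commute by blast+
  then show False
    using diamond_outside[OF D, of p] diamond_outside[OF D, of q] na T out by blast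
qed

lemma no_diamond_with_stable:
  assumes D: "triangle a b u" "triangle a b v" "u \<noteq> v" "\<not> E u v"
  shows "\<not> stable x y z"
proof
  assume S: "stable x y z"
  note T = D(1,2)[unfolded triangle_def] S[unfolded stable_def]
  have S': "stable x z y" "stable y x z" "stable y z x" "stable z x y" "stable z y x"
    using S triangle_perm(3,4) by blast+
  have D': "triangle b a u" "triangle b a v" "v \<noteq> u" "\<not> E v u"
    using D triangle_perm E_commute by blast+
  have ends: "\<not> stable w p q" if "w \<in> {a, b, u, v}" for w p q
    using that diamond_stable_end[OF D] diamond_stable_end[OF D(2,1) D'(3,4)]
      diamond_stable_centre[OF D] diamond_stable_centre[OF D'(1,2) D(3,4)] by blast
  have out: "x \<notin> {a, b, u, v}" "y \<notin> {a, b, u, v}" "z \<notin> {a, b, u, v}"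
    using S S' ends by blast+
  \<comment> \<open>A vertex \<open>w\<close> missing two of \<open>x\<close>, \<open>y\<close>,
    \<open>z\<close> would form a stable triple with them, against \<open>ends\<close>; one adjacent
    to all three would be the centre of a claw.\<close>
  have two: "(E x w \<and> E y w \<and> \<not> E z w) \<or> (E x w \<and> \<not> E y w \<and> E z w) \<or> (\<not> E x w \<and> E y w \<and> E z w)"
    if w: "w \<in> {a, b, u, v}" for w
  proof -
    have "w \<in> V" "w \<noteq> x" "w \<noteq> y" "w \<noteq> z"
      using T w out by auto
    then show ?thesis
      using ends[OF w, of x y] ends[OF w, of x z] ends[OF w, of y z] claw_free[OF S, of w] T E_commute
      unfolding stable_def by blast
  qed
  have cov: "E w a \<or> E w b \<or> E w u" "E w a \<or> E w b \<or> E w v" "E w u \<or> E w v" if "w \<in> {x, y, z}" for w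
    using diamond_outside[OF D, of w] that out T by blast+
  have edge_co: "E w p \<and> E w q \<longrightarrow> E w' w \<or> E w' p \<or> E w' q"
    if "w \<in> {x, y, z}" "w' \<in> {x, y, z}" "w \<noteq> w'" "p \<in> {a, b, u, v}" "q \<in> {a, b, u, v}" "E p q" for w w' p q
  proof -
    have "w \<in> V" "w' \<in> V" "p \<in> V" "q \<in> V" "w' \<noteq> p" "w' \<noteq> q"
      using that T out by auto
    then show ?thesis
      using coclaw_free[of w p q w'] that by (auto simp: triangle_def)
  qed
  have nonadj: "\<not> E w w'" if "w \<in> {x, y, z}" "w' \<in> {x, y, z}" for w w'
    using that T E_irrefl E_commute by blast
  have co: "\<not> (E w p \<and> E w q \<and> \<not> E w' p \<and> \<not> E w' q)"
    if "w \<in> {x, y, z}" "w' \<in> {x, y, z}" "w \<noteq> w'" "(p, q) \<in> {(a, b), (a, u), (a, v), (b, u), (b, v)}" for w w' p q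
  proof -
    have "E p q" "p \<in> {a, b, u, v}" "q \<in> {a, b, u, v}"
      using that(4) T by auto
    then show ?thesis
      using edge_co[OF that(1-3), of p q] nonadj that(1-3) by blast
  qed
  note co' = co[of _ _ a b, simplified] co[of _ _ a u, simplified] co[of _ _ a v, simplified]
    co[of _ _ b u, simplified] co[of _ _ b v, simplified]
  have ne: "x \<noteq> y" "x \<noteq> z" "y \<noteq> z" "y \<noteq> x" "z \<noteq> x" "z \<noteq> y"
    using T by auto
  \<comment> \<open>By \<open>two\<close>, each vertex of the diamond misses exactly one of
    \<open>x\<close>, \<open>y\<close>, \<open>z\<close>. Adjacent ones miss different vertices by
    \<open>co\<close>, and so do \<open>u\<close> and \<open>v\<close> by \<open>cov\<close>: four
    vertices would need four different values among three.\<close>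
  show False
    using two[of a] two[of b] two[of u] two[of v] cov[of x] cov[of y] cov[of z]
      co'[of x y] co'[of y x] co'[of x z] co'[of z x] co'[of y z] co'[of z y] ne
    by simp argo
qed

text \<open>If \<open>p\<close> misses \<open>a\<close>, then \<open>coclaw_free\<close> on the
  three triangles at \<open>a\<close> gives \<open>p\<close> two neighbours among \<open>b\<close>,
  \<open>u\<close>, \<open>v\<close>; these with \<open>a\<close> and \<open>p\<close> form a
  diamond.\<close>

lemma K4_joined_to_outside:
  assumes T: "triangle a b u" "triangle a b v" "triangle a u v" "triangle b u v"
    and S: "stable x y z" and p: "p \<in> V" "p \<notin> {a, b, u, v}"
  shows "E p a"
proof (rule ccontr)
  assume na: "\<not> E p a"
  have "\<not> (E p g \<and> E p h)" if "triangle a g h" for g h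
  proof
    assume "E p g \<and> E p h"
    then have "triangle g h a" "triangle g h p" "a \<noteq> p" "\<not> E a p"
      using that p na E_commute by (auto simp: triangle_def)
    then show False
      using no_diamond_with_stable S by blast
  qed
  from this[OF T(1)] this[OF T(2)] this[OF T(3)] show False
    using coclaw_free[OF T(1) p(1)] coclaw_free[OF T(2) p(1)] coclaw_free[OF T(3) p(1)] p(2) na
    by blast
qed

text \<open>The four vertices are adjacent to everything else, so a stable triple avoids them and
  \<open>a\<close> is the centre of a claw on it.\<close>

lemma no_K4_with_stable:
  assumes T: "triangle a b u" "triangle a b v" "triangle a u v" "triangle b u v"
  shows "\<not> stable x y z"
proof
  assume S: "stable x y z"
  note E = T[unfolded triangle_def] S[unfolded stable_def]
  have T': "triangle b a u" "triangle b a v" "triangle u a b" "triangle u a v" "triangle u b v"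
    "triangle v a b" "triangle v a u" "triangle v b u"
    using T triangle_perm by blast+
  have joined: "E p q" if "p \<in> V" "p \<notin> {a, b, u, v}" "q \<in> {a, b, u, v}" for p q
    using K4_joined_to_outside[OF T S that(1)]
      K4_joined_to_outside[OF T'(1,2) T(4,3) S that(1)]
      K4_joined_to_outside[OF T'(3,4,5) T(2) S that(1)]
      K4_joined_to_outside[OF T'(6-8) T(1) S that(1)] that(2,3) by blast
  have clique: "E p q" if "p \<in> {a, b, u, v}" "q \<in> {a, b, u, v}" "p \<noteq> q" for p q
    using that E E_sym by blast
  have "x \<notin> {a, b, u, v}" "y \<notin> {a, b, u, v}" "z \<notin> {a, b, u, v}"
    using joined clique E E_sym by metis+
  then show False
    using joined claw_free[OF S, of a] E E_sym by blast
qed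

text \<open>No neighbour would give a co-claw, two a diamond, and three a complete graph on four
  vertices.\<close>

lemma unique_nbr_in_triangle:
  assumes "triangle a b u" "stable x y z" "p \<in> V" "p \<noteq> a" "p \<noteq> b" "p \<noteq> u"
  shows "E p a \<and> \<not> E p b \<and> \<not> E p u \<or> \<not> E p a \<and> E p b \<and> \<not> E p u \<or> \<not> E p a \<and> \<not> E p b \<and> E p u"
proof -
  note t = assms(1)[unfolded triangle_def]
  have s: "E b a" "E u a" "E u b"
    using t E_sym by blast+
  have "\<not> (E p a \<and> E p b \<and> E p u)"
    using no_K4_with_stable[of a b u p] assms t E_commute by (auto simp: triangle_def)
  moreover have "\<not> (E p a \<and> E p b \<and> \<not> E p u)"
    using no_diamond_with_stable[of a b u p] assms t E_commute by (auto simp: triangle_def)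
  moreover have "\<not> (E p a \<and> \<not> E p b \<and> E p u)"
    using no_diamond_with_stable[of a u b p] assms t s E_commute by (auto simp: triangle_def)
  moreover have "\<not> (\<not> E p a \<and> E p b \<and> E p u)"
    using no_diamond_with_stable[of b u a p] assms t s E_commute by (auto simp: triangle_def)
  ultimately show ?thesis
    using coclaw_free[OF assms(1,3-6)] by blast
qed

text \<open>This is \<open>unique_nbr_in_triangle\<close> in the complement, where triangles and
  stable triples trade places.\<close>

lemma two_nbrs_in_stable:
  assumes "triangle a b u" "stable x y z" "p \<in> V" "p \<noteq> x" "p \<noteq> y" "p \<noteq> z"
  shows "\<not> E p x \<and> E p y \<and> E p z \<or> E p x \<and> \<not> E p y \<and> E p z \<or> E p x \<and> E p y \<and> \<not> E p z"
proof -
  interpret compl: two_coloured_graph V "\<lambda>x y. x \<noteq> y \<and> \<not> E x y" d c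
    by (rule complement)
  have "compl.triangle x y z"
    using assms(2) by (auto simp: compl.triangle_def stable_def)
  moreover have "compl.stable a b u"
    using assms(1) E_irrefl by (auto simp: compl.stable_def triangle_def)
  ultimately show ?thesis
    using compl.unique_nbr_in_triangle[of x y z a b u p] assms by auto
qed

section \<open>Coordinates in the grid\<close>

definition grid_embedding :: "('a \<Rightarrow> nat \<times> nat) \<Rightarrow> bool" where
  "grid_embedding f \<longleftrightarrow> inj_on f V \<and> f ` V \<subseteq> {0, 1, 2} \<times> {0, 1, 2} \<and>
    (\<forall>x\<in>V. \<forall>y\<in>V. x \<noteq> y \<longrightarrow> (E x y \<longleftrightarrow> (fst (f x) = fst (f y)) \<noteq> (snd (f x) = snd (f y))))"

text \<open>Row 0 of the grid is a triangle; a vertex outside lies in the column of its unique neighbour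
  in the triangle, and outside row 0 two vertices in different columns share a row iff adjacent.\<close>

lemma ex_grid_embedding:
  assumes T: "triangle t0 t1 t2" and S: "stable x y z"
  shows "\<exists>f. grid_embedding f"
proof -
  define t where "t i = (if i = 0 then t0 else if i = 1 then t1 else t2)" for i :: nat
  define N where "N = {0, 1, 2 :: nat}"
  have tri: "t i \<in> V" "E (t i) (t j)" "t i \<noteq> t j" if "i \<in> N" "j \<in> N" "i \<noteq> j" for i j
    using that T E_commute E_irrefl by (auto simp: t_def N_def triangle_def)
  have tV: "t i \<in> V" if "i \<in> N" for i
    using that T by (auto simp: t_def N_def triangle_def)
  define W where "W = V - t ` N"
  have W_V: "w \<in> V" if "w \<in> W" for w
    using that by (simp add: W_def)
  have W_t: "w \<noteq> t i" if "w \<in> W" "i \<in> N" for w i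
    using that by (auto simp: W_def)
  have "\<exists>i\<in>N. E w (t i) \<and> (\<forall>j\<in>N. E w (t j) \<longrightarrow> j = i)" if "w \<in> W" for w
    using unique_nbr_in_triangle[OF T S, of w] that by (auto simp: W_def N_def t_def)
  then obtain k where k: "\<And>w. w \<in> W \<Longrightarrow> k w \<in> N" "\<And>w. w \<in> W \<Longrightarrow> E w (t (k w))"
    and k': "\<And>w j. w \<in> W \<Longrightarrow> j \<in> N \<Longrightarrow> E w (t j) \<Longrightarrow> j = k w"
    by metis
  have wt: "E w (t j) \<longleftrightarrow> k w = j" "E (t j) w \<longleftrightarrow> k w = j" if "w \<in> W" "j \<in> N" for w j
    using k k' that E_commute by metis+
  have other: "\<exists>j\<in>N. j \<noteq> i \<and> j \<noteq> i'" for i i'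
    by (auto simp: N_def)
  \<comment> \<open>Otherwise \<open>t (k v)\<close> is the centre of a claw with ends
    \<open>v\<close>, \<open>w\<close> and another vertex \<open>t j\<close> of row 0.\<close>
  have same_col: "E v w" if "v \<in> W" "w \<in> W" "v \<noteq> w" "k v = k w" for v w
  proof (rule ccontr)
    assume "\<not> E v w"
    obtain j where j: "j \<in> N" "j \<noteq> k v"
      using other by blast
    have "stable v w (t j)"
      using that \<open>\<not> E v w\<close> j wt W_V W_t tV by (auto simp: stable_def)
    then show False
      using claw_free[of v w "t j" "t (k v)"] tri(2)[of "k v" j] wt that k(1) j tV by metis
  qed
  \<comment> \<open>\<open>w\<close> misses \<open>t (k v)\<close>, so its unique neighbour in the
    triangle \<open>t (k v)\<close>, \<open>v\<close>, \<open>v'\<close> is \<open>v\<close> or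
    \<open>v'\<close>.\<close>
  have one_of_two: "E w v \<longleftrightarrow> \<not> E w v'"
    if "v \<in> W" "v' \<in> W" "v \<noteq> v'" "k v = k v'" "w \<in> W" "k w \<noteq> k v" for v v' w
  proof -
    have "triangle (t (k v)) v v'"
      using that same_col wt W_V tV k by (auto simp: triangle_def)
    moreover have "\<not> E w (t (k v))" "w \<noteq> v" "w \<noteq> v'" "w \<noteq> t (k v)"
      using that k wt W_t by auto
    ultimately show ?thesis
      using unique_nbr_in_triangle[OF _ S] W_V[OF \<open>w \<in> W\<close>] by blast
  qed
  have col_le_2: "u = v \<or> u = w \<or> v = w"
    if "u \<in> W" "v \<in> W" "w \<in> W" "k u = k v" "k v = k w" for u v w
  proof (rule ccontr)
    assume "\<not> ?thesis"
    then have "triangle u v w"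
      using that same_col W_V by (auto simp: triangle_def)
    then show False
      using unique_nbr_in_triangle[OF _ S, of u v w "t (k u)"] that wt W_t tV k(1) by metis
  qed
  \<comment> \<open>Otherwise \<open>v\<close> is the centre of a claw with ends \<open>u\<close>,
    \<open>w\<close> and \<open>t (k v)\<close>.\<close>
  have row_trans: "E u w" if "u \<in> W" "v \<in> W" "w \<in> W" "k u \<noteq> k v" "k v \<noteq> k w" "k u \<noteq> k w" "E u v" "E v w" for u v w
  proof (rule ccontr)
    assume "\<not> E u w"
    then have "stable u w (t (k v))"
      using that k(1) wt W_V W_t tV by (auto simp: stable_def)
    then show False
      using claw_free[of u w "t (k v)" v] that k W_V E_commute by metis
  qed
  \<comment> \<open>Otherwise \<open>u\<close>, \<open>v\<close>, \<open>w\<close> is a stable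
    triple in which \<open>t (k u)\<close> has \<open>u\<close> as its only neighbour instead of
    two.\<close>
  have no_third_row: "E u v \<or> E u w \<or> E v w"
    if "u \<in> W" "v \<in> W" "w \<in> W" "k u \<noteq> k v" "k v \<noteq> k w" "k u \<noteq> k w" for u v w
  proof (rule ccontr)
    assume "\<not> ?thesis"
    then have "stable u v w"
      using that W_V by (auto simp: stable_def)
    then show False
      using two_nbrs_in_stable[OF T, of u v w "t (k u)"] that wt W_t tV k(1) by metis
  qed
  \<comment> \<open>An arbitrary vertex \<open>r\<close> of \<open>W\<close> fixes row 1, and
    \<open>P\<close> selects the vertices of that row. If \<open>W\<close> is empty,
    \<open>r\<close> is a dummy.\<close>
  define r where "r = (SOME r. r \<in> W)"
  have r: "r \<in> W" if "W \<noteq> {}"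
    using that unfolding r_def by (simp add: some_in_eq)
  define P where "P w \<longleftrightarrow> w = r \<or> (k w \<noteq> k r \<and> E w r)" for w
  have P_same: "P v \<noteq> P w" if "v \<in> W" "w \<in> W" "v \<noteq> w" "k v = k w" for v w
  proof -
    have "r \<in> W"
      using r that by blast
    show ?thesis
    proof (cases "k v = k r")
      case True
      then have "k w = k r"
        using that(4) by simp
      then have "v = r \<or> w = r"
        using col_le_2[OF \<open>v \<in> W\<close> \<open>w \<in> W\<close> \<open>r \<in> W\<close>] that(3,4) by blast
      then show ?thesis
        using True \<open>k w = k r\<close> that(3) unfolding P_def by blast
    next
      case False
      then have "E r v \<longleftrightarrow> \<not> E r w"
        using one_of_two[OF that \<open>r \<in> W\<close>] by (metis (full_types))
      then show ?thesis
        using False that(4) E_commute unfolding P_def by metis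
    qed
  qed
  have P_other: "E v w \<longleftrightarrow> P v = P w" if "v \<in> W" "w \<in> W" "k v \<noteq> k w" for v w
  proof -
    have "r \<in> W"
      using r that by blast
    consider "v = r" | "w = r" | "v \<noteq> r" "k v = k r" | "w \<noteq> r" "k w = k r" | "k v \<noteq> k r" "k w \<noteq> k r"
      by blast
    then show ?thesis
    proof cases
      case 1
      then show ?thesis
        using that(3) E_commute unfolding P_def by metis
    next
      case 2
      then show ?thesis
        using that(3) unfolding P_def by metis
    next
      case 3
      then have "E w v \<longleftrightarrow> \<not> E w r"
        using one_of_two[OF \<open>v \<in> W\<close> \<open>r \<in> W\<close> _ _ \<open>w \<in> W\<close>] that(3) by metis
      then show ?thesis
        using 3 that(3) E_commute unfolding P_def by metis
    next
      case 4
      then have "E v w \<longleftrightarrow> \<not> E v r"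
        using one_of_two[OF \<open>w \<in> W\<close> \<open>r \<in> W\<close> _ _ \<open>v \<in> W\<close>] that(3) by metis
      then show ?thesis
        using 4 that(3) unfolding P_def by metis
    next
      case 5
      have W: "v \<in> W" "w \<in> W" "r \<in> W"
        by fact+
      have ne: "k v \<noteq> k r" "k r \<noteq> k w" "k v \<noteq> k w" "k w \<noteq> k r" "k r \<noteq> k v" "k w \<noteq> k v"
        using 5 that(3) by simp_all
      have P: "P v \<longleftrightarrow> E v r" "P w \<longleftrightarrow> E w r"
        using ne unfolding P_def by metis+
      \<comment> \<open>In three different columns, adjacency is transitive and some pair is
        adjacent; hence \<open>v\<close> and \<open>w\<close> are adjacent iff both or neither are
        adjacent to \<open>r\<close>.\<close>
      have "E v r \<Longrightarrow> E r w \<Longrightarrow> E v w" "E w v \<Longrightarrow> E v r \<Longrightarrow> E w r" "E v w \<Longrightarrow> E w r \<Longrightarrow> E v r"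
        "E v w \<or> E v r \<or> E w r"
        using row_trans W ne no_third_row by metis+
      then show ?thesis
        unfolding P using E_commute[of w v] E_commute[of r w] by argo
    qed
  qed
  have inj_t: "inj_on t N"
    using tri(3) by (auto simp: inj_on_def)
  define col where "col v = (if v \<in> W then k v else inv_into N t v)" for v
  define row where "row v = (if v \<in> W then if P v then 1 else 2 else 0 :: nat)" for v
  have col_t: "col (t i) = i" "row (t i) = 0" if "i \<in> N" for i
    using that inj_t by (auto simp: col_def row_def W_def)
  have col_W: "col w = k w" "row w = (if P w then 1 else 2)" if "w \<in> W" for w
    using that by (auto simp: col_def row_def)
  have V_cases: "v \<in> W \<or> (\<exists>i\<in>N. v = t i)" if "v \<in> V" for v
    using that by (auto simp: W_def)
  have main: "(row v, col v) \<noteq> (row w, col w)" "E v w \<longleftrightarrow> (row v = row w) \<noteq> (col v = col w)"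
    if "v \<in> V" "w \<in> V" "v \<noteq> w" for v w
  proof -
    have "(row v, col v) \<noteq> (row w, col w) \<and> (E v w \<longleftrightarrow> (row v = row w) \<noteq> (col v = col w))"
    proof -
      consider "v \<in> W" "w \<in> W" | i where "v \<in> W" "i \<in> N" "w = t i" | i where "i \<in> N" "v = t i" "w \<in> W"
        | i j where "i \<in> N" "j \<in> N" "v = t i" "w = t j"
        using V_cases \<open>v \<in> V\<close> \<open>w \<in> V\<close> by metis
      then show ?thesis
      proof cases
        case 1
        then show ?thesis
          using P_same[of v w] P_other[of v w] same_col[of v w] \<open>v \<noteq> w\<close> by (auto simp: col_W)
      next
        case 2
        then show ?thesis
          using wt by (auto simp: col_W col_t)
      next
        case 3
        then show ?thesis
          using wt by (auto simp: col_W col_t)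
      next
        case 4
        then show ?thesis
          using tri(2) \<open>v \<noteq> w\<close> by (auto simp: col_t)
      qed
    qed
    then show "(row v, col v) \<noteq> (row w, col w)" "E v w \<longleftrightarrow> (row v = row w) \<noteq> (col v = col w)"
      by blast+
  qed
  have "row v \<in> {0, 1, 2}" "col v \<in> {0, 1, 2}" if "v \<in> V" for v
    using V_cases[OF that] k(1)[of v] by (auto simp: col_t col_W N_def row_def)
  then have "(\<lambda>v. (row v, col v)) ` V \<subseteq> {0, 1, 2} \<times> {0, 1, 2}"
    by blast
  moreover have "inj_on (\<lambda>v. (row v, col v)) V"
    using main(1) by (meson inj_onI)
  moreover have "\<forall>x\<in>V. \<forall>y\<in>V. x \<noteq> y \<longrightarrow>
      (E x y \<longleftrightarrow> (fst (row x, col x) = fst (row y, col y)) \<noteq> (snd (row x, col x) = snd (row y, col y)))"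
    unfolding fst_conv snd_conv using main(2) by meson
  ultimately show ?thesis
    unfolding grid_embedding_def by blast
qed

end

subsection \<open>Proper 2-edge-colourings\<close>

text \<open>The map goes from the model \<open>H\<close> to \<open>G\<close>, the direction in which
  a walk parametrises a component.\<close>

lemma isomorphicI:
  assumes "bij_betw w (verts H) (verts G)"
    and "\<And>i j. i \<in> verts H \<Longrightarrow> j \<in> verts H \<Longrightarrow> {w i, w j} \<in> edges G \<longleftrightarrow> {i, j} \<in> edges H"
  shows "isomorphic G H"
proof -
  have "bij_betw (inv_into (verts H) w) (verts G) (verts H)"
    using assms(1) by (rule bij_betw_inv_into)
  moreover have "{x, y} \<in> edges G \<longleftrightarrow> {inv_into (verts H) w x, inv_into (verts H) w y} \<in> edges H"
    if "x \<in> verts G" "y \<in> verts G" for x y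
  proof -
    have "inv_into (verts H) w x \<in> verts H" "inv_into (verts H) w y \<in> verts H"
      using that assms(1) by (simp_all add: bij_betw_def inv_into_into)
    moreover have "w (inv_into (verts H) w x) = x" "w (inv_into (verts H) w y) = y"
      using that bij_betw_inv_into_right[OF assms(1)] by simp_all
    ultimately show ?thesis
      using assms(2)[of "inv_into (verts H) w x" "inv_into (verts H) w y"] by simp
  qed
  ultimately show ?thesis
    unfolding isomorphic_def by blast
qed

text \<open>This is the triangle-free situation: a vertex has at most one edge of each colour, hence
  degree at most two.\<close>

locale edge_coloured_graph =
  fixes U :: "'a graph" and c :: "'a set \<Rightarrow> bool"
  assumes graph: "is_graph U"
    and proper: "y \<noteq> z \<Longrightarrow> {x, y} \<in> edges U \<Longrightarrow> {x, z} \<in> edges U \<Longrightarrow> c {x, y} \<noteq> c {x, z}"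
begin

text \<open>The neighbour along the edge of colour \<open>b\<close>; the default \<open>x\<close>
  makes \<open>partner b\<close> a total involution.\<close>

definition partner :: "bool \<Rightarrow> 'a \<Rightarrow> 'a" where
  "partner b x = (if \<exists>y. {x, y} \<in> edges U \<and> c {x, y} = b
     then THE y. {x, y} \<in> edges U \<and> c {x, y} = b else x)"

lemma partner_eq: "{x, y} \<in> edges U \<Longrightarrow> c {x, y} = b \<Longrightarrow> partner b x = y"
proof -
  assume y: "{x, y} \<in> edges U" "c {x, y} = b"
  have "(THE y. {x, y} \<in> edges U \<and> c {x, y} = b) = y"
  proof (rule the_equality)
    show "z = y" if "{x, z} \<in> edges U \<and> c {x, z} = b" for z
      using proper[of z y x] that y by blast
  qed (use y in blast)
  then show ?thesis
    using y unfolding partner_def by metis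
qed

lemma partner_cases:
  obtains "partner b x = x" | "{x, partner b x} \<in> edges U" "c {x, partner b x} = b"
proof (cases "\<exists>y. {x, y} \<in> edges U \<and> c {x, y} = b")
  case True
  then obtain y where y: "{x, y} \<in> edges U" "c {x, y} = b"
    by blast
  then have "partner b x = y"
    by (rule partner_eq)
  then show thesis
    using that(2) y by simp
next
  case False
  then have "partner b x = x"
    unfolding partner_def by (rule if_not_P)
  then show thesis
    by (rule that(1))
qed

lemma partner_edge:
  assumes "partner b x \<noteq> x"
  shows "{x, partner b x} \<in> edges U" "c {x, partner b x} = b"
  by (cases rule: partner_cases[of b x]; use assms in simp)+

lemma partner_partner: "partner b (partner b x) = x"
proof (cases rule: partner_cases[of b x])
  case 2
  then show ?thesis
    by (intro partner_eq) (simp_all add: insert_commute)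
qed simp

section \<open>The alternating walk through a component\<close>

fun walk_nat :: "'a \<Rightarrow> bool \<Rightarrow> nat \<Rightarrow> 'a" where
  "walk_nat v b 0 = v"
| "walk_nat v b (Suc n) = partner (even n = b) (walk_nat v b n)"

text \<open>Forwards the first colour is \<open>True\<close>, backwards \<open>False\<close>, so the
  step between times \<open>k\<close> and \<open>k + 1\<close> uniformly has colour
  \<open>even k\<close>.\<close>

definition walk :: "'a \<Rightarrow> int \<Rightarrow> 'a" where
  "walk v k = (if k \<ge> 0 then walk_nat v True (nat k) else walk_nat v False (nat (- k)))"

lemma walk_0 [simp]: "walk v 0 = v"
  by (simp add: walk_def)

lemma walk_next: "walk v (k + 1) = partner (even k) (walk v k)"
proof (cases "k \<ge> 0")
  case True
  then show ?thesis
    by (simp add: walk_def nat_add_distrib even_nat_iff)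
next
  case False
  define n where "n = nat (- k - 1)"
  have k: "k = - int n - 1" and "nat (- k) = Suc n"
    using False by (auto simp: n_def)
  then have "walk v k = partner (\<not> even n) (walk_nat v False n)"
    using False by (simp add: walk_def)
  moreover have "even k \<longleftrightarrow> \<not> even n"
    by (simp add: k)
  moreover have "walk v (k + 1) = walk_nat v False n"
    by (simp add: k walk_def)
  ultimately show ?thesis
    by (simp add: partner_partner)
qed

lemma walk_prev: "walk v (k - 1) = partner (odd k) (walk v k)"
  using walk_next[of v "k - 1"] by (simp add: partner_partner)

lemma walk_partner: "partner b (walk v k) = (if b = even k then walk v (k + 1) else walk v (k - 1))"
  by (auto simp: walk_next walk_prev)

text \<open>An even shift of time preserves the colours of the steps, so equal positions have equal
  continuations.\<close>

lemma walk_translate: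
  assumes "walk v n = walk v m" "even (n - m)"
  shows "walk v (n + k) = walk v (m + k)"
proof (induction k rule: int_induct[of _ 0])
  case (step1 i)
  then show ?case
    using walk_next[of v "n + i"] walk_next[of v "m + i"] assms(2) by (simp add: add.assoc)
next
  case (step2 i)
  then show ?case
    using walk_prev[of v "n + i"] walk_prev[of v "m + i"] assms(2) by (simp add: add_diff_eq)
qed (use assms in simp)

lemma walk_periodic:
  assumes "walk v n = walk v m" "even (n - m)"
  shows "walk v (k + j * (n - m)) = walk v k"
proof (induction j rule: int_induct[of _ 0])
  case (step1 i)
  then show ?case
    using walk_translate[OF assms, of "k + i * (n - m) - m"] by (simp add: algebra_simps)
next
  case (step2 i)
  then show ?case
    using walk_translate[OF assms, of "k + (i - 1) * (n - m) - m"] by (simp add: algebra_simps)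
qed simp

text \<open>For odd \<open>n - m\<close>, the step forwards from \<open>n\<close> has the same
  colour as the step backwards from \<open>m\<close>.\<close>

lemma walk_reflect:
  assumes "walk v n = walk v m" "odd (n - m)"
  shows "walk v (n + k) = walk v (m - k)"
proof (induction k rule: int_induct[of _ 0])
  case (step1 i)
  then show ?case
    using walk_next[of v "n + i"] walk_prev[of v "m - i"] assms(2)
    by (simp add: algebra_simps)
next
  case (step2 i)
  then show ?case
    using walk_prev[of v "n + i"] walk_next[of v "m - i"] assms(2)
    by (simp add: algebra_simps)
qed (use assms in simp)

text \<open>The neighbours of a vertex are its partners of the two colours;
  \<open>x \<noteq> walk v i\<close> discards a missing one.\<close>

lemma walk_edge_iff:
  "{walk v i, x} \<in> edges U \<longleftrightarrow> x \<noteq> walk v i \<and> (x = walk v (i + 1) \<or> x = walk v (i - 1))"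
proof
  assume e: "{walk v i, x} \<in> edges U"
  then have "partner (c {walk v i, x}) (walk v i) = x"
    by (simp add: partner_eq)
  then show "x \<noteq> walk v i \<and> (x = walk v (i + 1) \<or> x = walk v (i - 1))"
    using edges_pairD(3)[OF graph e] walk_partner by metis
next
  assume "x \<noteq> walk v i \<and> (x = walk v (i + 1) \<or> x = walk v (i - 1))"
  then show "{walk v i, x} \<in> edges U"
    using partner_edge(1)[of _ "walk v i"] by (auto simp: walk_next walk_prev)
qed

text \<open>The range is closed under adjacency, and each step of the walk follows an edge or stands
  still.\<close>

lemma walk_range:
  assumes "v \<in> verts U"
  shows "connectivity U `` {v} = range (walk v)"
proof
  let ?R = "{(x, y). {x, y} \<in> edges U}"
  have "(v, y) \<in> ?R\<^sup>* \<Longrightarrow> y \<in> range (walk v)" for y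
  proof (induction rule: rtrancl_induct)
    case base
    show ?case
      using walk_0 by (metis rangeI)
  next
    case (step y z)
    then show ?case
      using walk_edge_iff by blast
  qed
  then show "connectivity U `` {v} \<subseteq> range (walk v)"
    by (auto simp: connectivity_def)
  have next_step: "(v, partner b x) \<in> connectivity U" if "(v, x) \<in> connectivity U" for b x
  proof (cases rule: partner_cases[of b x])
    case 2
    then show ?thesis
      using that edges_pairD[OF graph 2(1)]
      by (auto simp: connectivity_def intro: rtrancl_into_rtrancl)
  qed (use that in simp)
  have "(v, walk v k) \<in> connectivity U" for k
  proof (induction k rule: int_induct[of _ 0])
    case base
    show ?case
      using assms by (simp add: connectivity_def)
  qed (simp_all add: walk_next walk_prev next_step)
  then show "range (walk v) \<subseteq> connectivity U `` {v}"
    by blast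
qed

text \<open>At such a time the vertex reached has no edge of colour \<open>even k\<close>.\<close>

definition turns :: "'a \<Rightarrow> int set" where
  "turns v = {k. walk v (k + 1) = walk v k}"

text \<open>After a turn the walk runs back along its own trace, so a path component is traversed once by the maximal
  interval of times around 0 without a turn.\<close>

definition turn_free :: "'a \<Rightarrow> int set" where
  "turn_free v = {i. \<forall>k\<in>turns v. \<not> (0 \<le> k \<and> k < i) \<and> \<not> (i \<le> k \<and> k < 0)}"

lemma turn_free_convex: "a \<in> turn_free v \<Longrightarrow> b \<in> turn_free v \<Longrightarrow> {a..b} \<subseteq> turn_free v"
  by (force simp: turn_free_def)

lemma turn_free_0: "0 \<in> turn_free v"
  by (simp add: turn_free_def)

lemma turn_free_next:
  assumes "i \<in> turn_free v"
  shows "i + 1 \<in> turn_free v \<longleftrightarrow> i \<notin> turns v"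
proof -
  have "k < i + 1 \<longleftrightarrow> k < i \<or> k = i" "i \<le> k \<longleftrightarrow> i + 1 \<le> k \<or> k = i" for k
    by auto
  then show ?thesis
    using assms unfolding turn_free_def mem_Collect_eq by (metis not_le)
qed

lemma turn_free_prev:
  assumes "i \<in> turn_free v"
  shows "i - 1 \<in> turn_free v \<longleftrightarrow> i - 1 \<notin> turns v"
proof -
  have "k < i \<longleftrightarrow> k < i - 1 \<or> k = i - 1" "i - 1 \<le> k \<longleftrightarrow> i \<le> k \<or> k = i - 1" for k
    by auto
  then show ?thesis
    using assms unfolding turn_free_def mem_Collect_eq by (metis not_le)
qed

lemma no_turn_between: "n \<in> turn_free v \<Longrightarrow> m \<in> turn_free v \<Longrightarrow> k \<in> turns v \<Longrightarrow> n \<le> k \<Longrightarrow> \<not> k < m"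
  unfolding turn_free_def by force

text \<open>The walk stands still whenever time leaves the turn-free interval, so the vertices
  visited in the interval are closed under both partners.\<close>

lemma range_walk: "range (walk v) = walk v ` turn_free v"
proof -
  have nxt: "walk v (i + 1) \<in> walk v ` turn_free v" "walk v (i - 1) \<in> walk v ` turn_free v"
    if "i \<in> turn_free v" for i
  proof -
    have "walk v (i + 1) = walk v i" if "i \<in> turns v"
      using that by (simp add: turns_def)
    then show "walk v (i + 1) \<in> walk v ` turn_free v"
      using turn_free_next[OF that] that by (metis imageI)
    have "walk v (i - 1) = walk v i" if "i - 1 \<in> turns v"
      using that by (simp add: turns_def)
    then show "walk v (i - 1) \<in> walk v ` turn_free v"
      using turn_free_prev[OF that] that by (metis imageI)
  qed
  have closed: "partner b x \<in> walk v ` turn_free v" if "x \<in> walk v ` turn_free v" for b x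
    using that nxt walk_partner by (smt (verit) imageE)
  have "walk v k \<in> walk v ` turn_free v" for k
  proof (induction k rule: int_induct[of _ 0])
    case base
    show ?case
      using turn_free_0 by blast
  qed (simp_all add: walk_next walk_prev closed)
  then show ?thesis
    by blast
qed

text \<open>A repetition at odd distance reflects the walk and forces a turn halfway. At even
  distance it makes the walk periodic, so any turn would recur between \<open>n\<close> and
  \<open>m\<close>.\<close>

lemma walk_eq_in_turn_free:
  assumes "n \<in> turn_free v" "m \<in> turn_free v" "n < m" "walk v n = walk v m"
  shows "even (m - n)" "turns v = {}"
proof -
  show ev: "even (m - n)"
  proof (rule ccontr)
    assume odd: "odd (m - n)"
    define k where "k = (m - n) div 2"
    have k: "m = n + 2 * k + 1"
      using odd_two_times_div_two_succ[OF odd] unfolding k_def by linarith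
    have "walk v (n + k) = walk v (m - k)"
      using odd assms(4) by (intro walk_reflect) auto
    then have "n + k \<in> turns v"
      by (simp add: turns_def k algebra_simps)
    then show False
      using no_turn_between[OF assms(1,2)] assms(3) k by force
  qed
  show "turns v = {}"
  proof (rule ccontr)
    assume "turns v \<noteq> {}"
    then obtain f where f: "f \<in> turns v"
      by blast
    define p where "p = m - n"
    have p: "p > 0" "even p"
      using assms(3) ev by (auto simp: p_def)
    have shift: "walk v (k + j * p) = walk v k" for k j
      using walk_periodic[of v m n] assms(4) ev by (simp add: p_def)
    \<comment> \<open>The representative of \<open>f\<close> modulo the period \<open>p\<close> in
      the window from \<open>n\<close> to \<open>m - 1\<close>.\<close>
    define f' where "f' = n + (f - n) mod p"
    have f': "f' = f + (- ((f - n) div p)) * p"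
      by (simp add: f'_def minus_div_mult_eq_mod[symmetric])
    have "walk v (f' + 1) = walk v f'"
      using shift[of "f + 1" "- ((f - n) div p)"] shift[of f "- ((f - n) div p)"] f
      unfolding f' turns_def by (simp add: algebra_simps)
    then have "f' \<in> turns v"
      by (simp add: turns_def)
    moreover have "0 \<le> (f - n) mod p" "(f - n) mod p < p"
      using p(1) by simp_all
    then have "n \<le> f'" "f' < m"
      unfolding f'_def using p_def by linarith+
    ultimately show False
      using no_turn_between[OF assms(1,2)] by blast
  qed
qed

section \<open>Components as paths or even cycles\<close>

lemma pair_in_induced_iff:
  "{x, y} \<in> edges (induced_graph U A) \<longleftrightarrow> {x, y} \<in> edges U \<and> x \<in> A \<and> y \<in> A"
proof -
  have "{x, y} \<in> [A]\<^bsup>2\<^esup> \<longleftrightarrow> x \<in> A \<and> y \<in> A" if "x \<noteq> y"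
    using that by (auto simp: nsets_def)
  then show ?thesis
    using edges_pairD(3)[OF graph, of x y] by (auto simp: induced_graph_def)
qed

lemma component_is_path:
  assumes inj: "inj_on (walk v) (turn_free v)"
  shows "is_path (induced_graph U (range (walk v)))"
proof -
  let ?I = "turn_free v"
  have "isomorphic (induced_graph U (range (walk v))) (path_graph ?I)"
  proof (rule isomorphicI)
    show "bij_betw (walk v) (verts (path_graph ?I)) (verts (induced_graph U (range (walk v))))"
      using inj by (simp add: path_graph_def induced_graph_def bij_betw_def range_walk)
  next
    fix i j
    assume "i \<in> verts (path_graph ?I)" "j \<in> verts (path_graph ?I)"
    then have ij: "i \<in> ?I" "j \<in> ?I"
      by (simp_all add: path_graph_def)
    have eq: "walk v a = walk v b \<longleftrightarrow> a = b" if "a \<in> ?I" "b \<in> ?I" for a b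
      using inj that by (auto dest: inj_onD)
    \<comment> \<open>At a turn both sides fail: the walk stands still and \<open>i + 1\<close> lies
      outside the interval.\<close>
    have "walk v j \<noteq> walk v i \<and> walk v j = walk v (i + 1) \<longleftrightarrow> j = i + 1"
    proof (cases "i \<in> turns v")
      case True
      then have "j \<noteq> i + 1" "walk v (i + 1) = walk v i"
        using turn_free_next[OF ij(1)] ij(2) by (auto simp: turns_def)
      then show ?thesis
        by auto
    next
      case False
      then have "i + 1 \<in> ?I"
        using turn_free_next[OF ij(1)] by simp
      then show ?thesis
        using eq ij by auto
    qed
    moreover have "walk v j \<noteq> walk v i \<and> walk v j = walk v (i - 1) \<longleftrightarrow> j = i - 1"
    proof (cases "i - 1 \<in> turns v")
      case True
      then have "j \<noteq> i - 1" "walk v (i - 1) = walk v i"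
        using turn_free_prev[OF ij(1)] ij(2) by (auto simp: turns_def)
      then show ?thesis
        by auto
    next
      case False
      then have "i - 1 \<in> ?I"
        using turn_free_prev[OF ij(1)] by simp
      then show ?thesis
        using eq ij by auto
    qed
    ultimately have "{walk v i, walk v j} \<in> edges U \<longleftrightarrow> j = i + 1 \<or> j = i - 1"
      unfolding walk_edge_iff by blast
    also have "\<dots> \<longleftrightarrow> {i, j} \<in> edges (path_graph ?I)"
    proof
      assume "j = i + 1 \<or> j = i - 1"
      then have "{i, j} = {i, i + 1} \<and> i + 1 \<in> ?I \<or> {i, j} = {j, j + 1} \<and> j + 1 \<in> ?I"
        using ij by auto
      then show "{i, j} \<in> edges (path_graph ?I)"
        using ij unfolding path_graph_def snd_conv by blast
    next
      assume "{i, j} \<in> edges (path_graph ?I)"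
      then show "j = i + 1 \<or> j = i - 1"
        by (auto simp: path_graph_def doubleton_eq_iff)
    qed
    finally show "{walk v i, walk v j} \<in> edges (induced_graph U (range (walk v))) \<longleftrightarrow>
        {i, j} \<in> edges (path_graph ?I)"
      by (simp add: pair_in_induced_iff)
  qed
  then show ?thesis
    using turn_free_0 turn_free_convex unfolding is_path_def by (intro exI[of _ ?I]) blast
qed

lemma component_is_even_cycle:
  assumes eq: "walk v n = walk v m" "n < m" and no_turns: "turns v = {}"
  shows "even_cycle (induced_graph U (range (walk v)))"
proof -
  have tf: "k \<in> turn_free v" for k
    by (simp add: turn_free_def no_turns)
  have even_diff: "even (b - a)" if "walk v a = walk v b" for a b
  proof (cases a b rule: linorder_cases)
    case less
    then show ?thesis
      using walk_eq_in_turn_free(1)[OF tf tf _ that] by simp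
  next
    case greater
    then show ?thesis
      using walk_eq_in_turn_free(1)[OF tf tf _ that[symmetric]] by simp
  qed simp
  \<comment> \<open>The time of first return to \<open>v\<close>; it becomes the length of the
    cycle.\<close>
  define p where "p = (LEAST p. p > 0 \<and> walk v (int p) = walk v 0)"
  have "walk v (m - n) = walk v 0"
    using walk_translate[OF eq(1)[symmetric] even_diff[OF eq(1)], of "- n"] by simp
  then have "\<exists>p. p > 0 \<and> walk v (int p) = walk v 0"
    using eq(2) by (intro exI[of _ "nat (m - n)"]) simp
  then have "p > 0 \<and> walk v (int p) = walk v 0"
    unfolding p_def by (rule LeastI_ex)
  then have p: "p > 0" "walk v (int p) = walk v 0"
    by blast+
  have p_min: "p \<le> q" if "q > 0" "walk v (int q) = walk v 0" for q
    unfolding p_def using that by (simp add: Least_le)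
  have ev: "even p"
    using even_diff[of 0 "int p"] p by simp
  have per: "walk v (k + j * int p) = walk v k" for k j
    using walk_periodic[of v "int p" 0 k j] p(2) ev by simp
  have mod: "walk v (k mod int p) = walk v k" for k
    using per[of k "- (k div int p)"] by (simp add: minus_div_mult_eq_mod)
  have inj: "i = j" if "walk v i = walk v j" "0 \<le> i" "i \<le> j" "j < int p" for i j
  proof (rule ccontr)
    assume "i \<noteq> j"
    have "walk v (j - i) = walk v 0"
      using walk_translate[OF that(1)[symmetric] even_diff[OF that(1)], of "- i"] by simp
    then have "p \<le> nat (j - i)"
      using \<open>i \<noteq> j\<close> that by (intro p_min) auto
    then show False
      using that by simp
  qed
  have eq_iff: "walk v i = walk v j \<longleftrightarrow> i mod int p = j mod int p" for i j
  proof
    assume "walk v i = walk v j"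
    then have "walk v (i mod int p) = walk v (j mod int p)"
      by (simp add: mod)
    then show "i mod int p = j mod int p"
      using inj[of "i mod int p" "j mod int p"] inj[of "j mod int p" "i mod int p"] p(1) by force
  qed (metis mod)
  have next_ne: "walk v (k + 1) \<noteq> walk v k" for k
    using no_turns by (auto simp: turns_def)
  have prev_ne: "walk v (k - 1) \<noteq> walk v k" for k
    using next_ne[of "k - 1"] by simp
  \<comment> \<open>Otherwise both partners of \<open>v\<close> coincide, and one edge would carry
    both colours.\<close>
  have "p \<noteq> 2"
  proof
    assume "p = 2"
    then have "walk v 2 = walk v 0"
      using p(2) by simp
    then have "walk v (-1) = walk v 1"
      using walk_translate[of v 2 0 "-1"] by simp
    then have "partner True v = partner False v"
      using walk_next[of v 0] walk_prev[of v 0] by simp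
    moreover have "partner True v \<noteq> v"
      using next_ne[of 0] walk_next[of v 0] by simp
    ultimately show False
      using partner_edge(2)[of True v] partner_edge(2)[of False v] by simp
  qed
  then have p3: "p \<ge> 3"
    using p(1) ev by (cases "p = 1") auto
  have "isomorphic (induced_graph U (range (walk v))) (cycle_graph p)"
  proof (rule isomorphicI)
    have "inj_on (\<lambda>i. walk v (int i)) {..<p}"
      by (rule inj_onI) (simp add: eq_iff)
    moreover have "range (walk v) \<subseteq> (\<lambda>i. walk v (int i)) ` {..<p}"
    proof
      fix x
      assume "x \<in> range (walk v)"
      then obtain k where "x = walk v k"
        by blast
      then have "x = walk v (int (nat (k mod int p)))" "nat (k mod int p) < p"
        using p(1) by (simp_all add: mod nat_less_iff)
      then show "x \<in> (\<lambda>i. walk v (int i)) ` {..<p}"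
        by blast
    qed
    ultimately show "bij_betw (\<lambda>i. walk v (int i)) (verts (cycle_graph p))
        (verts (induced_graph U (range (walk v))))"
      by (auto simp: bij_betw_def cycle_graph_def induced_graph_def)
  next
    fix i j
    assume "i \<in> verts (cycle_graph p)" "j \<in> verts (cycle_graph p)"
    then have ij: "i < p" "j < p"
      by (simp_all add: cycle_graph_def)
    have step: "walk v (int b) = walk v (int a + 1) \<longleftrightarrow> b = Suc a mod p" if "b < p" for a b
    proof -
      have "walk v (int b) = walk v (int a + 1) \<longleftrightarrow> int b = int (Suc a mod p)"
        unfolding eq_iff using that by (simp add: zmod_int add.commute)
      then show ?thesis
        by (simp only: of_nat_eq_iff)
    qed
    have "walk v (int j) = walk v (int i - 1) \<longleftrightarrow> walk v (int i) = walk v (int j + 1)"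
    proof
      assume e: "walk v (int j) = walk v (int i - 1)"
      show "walk v (int i) = walk v (int j + 1)"
        using walk_translate[OF e even_diff[OF e[symmetric]], of 1] by simp
    next
      assume e: "walk v (int i) = walk v (int j + 1)"
      show "walk v (int j) = walk v (int i - 1)"
        using walk_translate[OF e even_diff[OF e[symmetric]], of "-1"] by simp
    qed
    then have "walk v (int j) = walk v (int i - 1) \<longleftrightarrow> i = Suc j mod p"
      using step ij by simp
    then have "{walk v (int i), walk v (int j)} \<in> edges U \<longleftrightarrow> j = Suc i mod p \<or> i = Suc j mod p"
      unfolding walk_edge_iff using step[OF ij(2)] next_ne prev_ne by metis
    also have "\<dots> \<longleftrightarrow> {i, j} \<in> edges (cycle_graph p)"
      using ij by (auto simp: cycle_graph_def doubleton_eq_iff)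
    finally show "{walk v (int i), walk v (int j)} \<in> edges (induced_graph U (range (walk v))) \<longleftrightarrow>
        {i, j} \<in> edges (cycle_graph p)"
      by (simp add: pair_in_induced_iff)
  qed
  then show ?thesis
    unfolding even_cycle_def using p3 ev by blast
qed

text \<open>An isolated vertex appears here as a path over a one-point interval.\<close>

lemma even_cycles_or_paths: "even_cycles_or_paths U"
proof -
  have "even_cycle C \<or> is_path C" if C: "C \<in> components U" for C
  proof -
    obtain v where v: "v \<in> verts U" "C = induced_graph U (connectivity U `` {v})"
      using C unfolding components_def quotient_def by blast
    have C: "C = induced_graph U (range (walk v))"
      using v walk_range by simp
    show ?thesis
    proof (cases "inj_on (walk v) (turn_free v)")
      case True
      then show ?thesis
        unfolding C by (simp add: component_is_path)
    next
      case False
      then obtain n m where nm: "n \<in> turn_free v" "m \<in> turn_free v" "n < m" "walk v n = walk v m"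
        unfolding inj_on_def by (metis linorder_neqE)
      then show ?thesis
        unfolding C using component_is_even_cycle[OF nm(4,3)] walk_eq_in_turn_free(2)[OF nm] by blast
    qed
  qed
  then show ?thesis
    unfolding even_cycles_or_paths_def by blast
qed

end

subsection \<open>Colourings of even cycles, paths and the grid\<close>

text \<open>Colouring an edge by whether its tail satisfies \<open>f\<close> gives a proper 2-edge-colouring.\<close>

definition alternating_orientation :: "'a graph \<Rightarrow> ('a \<Rightarrow> bool) \<Rightarrow> ('a \<Rightarrow> 'a \<Rightarrow> bool) \<Rightarrow> bool" where
  "alternating_orientation G f R \<longleftrightarrow>
    (\<forall>x\<in>verts G. \<forall>y\<in>verts G. {x, y} \<in> edges G \<longrightarrow> f x \<noteq> f y \<and> (R x y \<or> R y x)) \<and>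
    (\<forall>x\<in>verts G. \<forall>y\<in>verts G. \<forall>z\<in>verts G. (R x y \<and> R x z \<longrightarrow> y = z) \<and> (R y x \<and> R z x \<longrightarrow> y = z))"

lemma isomorphicE:
  assumes "isomorphic G H"
  obtains h where "bij_betw h (verts G) (verts H)"
    "\<And>x y. x \<in> verts G \<Longrightarrow> y \<in> verts G \<Longrightarrow> {x, y} \<in> edges G \<longleftrightarrow> {h x, h y} \<in> edges H"
  using assms unfolding isomorphic_def by blast

lemma even_cycle_alternating:
  assumes "even_cycle C"
  shows "\<exists>f R. alternating_orientation C f R"
proof -
  obtain n where n: "n \<ge> 3" "even n" and iso: "isomorphic C (cycle_graph n)"
    using assms by (auto simp: even_cycle_def)
  from iso obtain h where h: "bij_betw h (verts C) (verts (cycle_graph n))"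
    "\<And>x y. x \<in> verts C \<Longrightarrow> y \<in> verts C \<Longrightarrow> {x, y} \<in> edges C \<longleftrightarrow> {h x, h y} \<in> edges (cycle_graph n)"
    by (rule isomorphicE) blast
  have h_less: "h x < n" if "x \<in> verts C" for x
    using bij_betwE[OF h(1)] that by (auto simp: cycle_graph_def)
  have h_inj: "x = y" if "h x = h y" "x \<in> verts C" "y \<in> verts C" for x y
    using h(1) that by (auto simp: bij_betw_def dest: inj_onD)
  \<comment> \<open>Even length makes parity alternate also across the step from
    \<open>n - 1\<close> to \<open>0\<close>.\<close>
  have parity: "even (Suc i mod n) \<longleftrightarrow> odd i" for i
    using n(2) by (simp add: dvd_mod_iff)
  have suc_inj: "i = j" if "Suc i mod n = Suc j mod n" "i < n" "j < n" for i j
    using that by (auto simp: mod_Suc split: if_splits)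
  have "even (h x) \<noteq> even (h y) \<and> (h y = Suc (h x) mod n \<or> h x = Suc (h y) mod n)"
    if "x \<in> verts C" "y \<in> verts C" "{x, y} \<in> edges C" for x y
  proof -
    have "{h x, h y} \<in> edges (cycle_graph n)"
      using h(2) that by blast
    then have "h y = Suc (h x) mod n \<or> h x = Suc (h y) mod n"
      by (auto simp: cycle_graph_def doubleton_eq_iff)
    then show ?thesis
      using parity by metis
  qed
  moreover have "(h y = Suc (h x) mod n \<and> h z = Suc (h x) mod n \<longrightarrow> y = z) \<and>
      (h x = Suc (h y) mod n \<and> h x = Suc (h z) mod n \<longrightarrow> y = z)"
    if "y \<in> verts C" "z \<in> verts C" for x y z
    using that h_inj[of y z] suc_inj[of "h y" "h z"] h_less by simp
  ultimately have "alternating_orientation C (\<lambda>x. even (h x)) (\<lambda>x y. h y = Suc (h x) mod n)"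
    unfolding alternating_orientation_def by blast
  then show ?thesis
    by blast
qed

lemma path_alternating:
  assumes "is_path C"
  shows "\<exists>f R. alternating_orientation C f R"
proof -
  obtain I where iso: "isomorphic C (path_graph I)"
    using assms by (auto simp: is_path_def)
  from iso obtain h where h: "bij_betw h (verts C) (verts (path_graph I))"
    "\<And>x y. x \<in> verts C \<Longrightarrow> y \<in> verts C \<Longrightarrow> {x, y} \<in> edges C \<longleftrightarrow> {h x, h y} \<in> edges (path_graph I)"
    by (rule isomorphicE) blast
  have h_inj: "x = y" if "h x = h y" "x \<in> verts C" "y \<in> verts C" for x y
    using h(1) that by (auto simp: bij_betw_def dest: inj_onD)
  have "even (h x) \<noteq> even (h y) \<and> (h y = h x + 1 \<or> h x = h y + 1)"
    if "x \<in> verts C" "y \<in> verts C" "{x, y} \<in> edges C" for x y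
  proof -
    have "{h x, h y} \<in> edges (path_graph I)"
      using h(2) that by blast
    then show ?thesis
      by (auto simp: path_graph_def doubleton_eq_iff)
  qed
  moreover have "(h y = h x + 1 \<and> h z = h x + 1 \<longrightarrow> y = z) \<and> (h x = h y + 1 \<and> h x = h z + 1 \<longrightarrow> y = z)"
    if "y \<in> verts C" "z \<in> verts C" for x y z
    using that h_inj[of y z] by simp
  ultimately have "alternating_orientation C (\<lambda>x. even (h x)) (\<lambda>x y. h y = h x + 1)"
    unfolding alternating_orientation_def by blast
  then show ?thesis
    by blast
qed

lemma isolated_vertex_alternating:
  assumes "isolated_vertex C"
  shows "\<exists>f R. alternating_orientation C f R"
proof -
  have "alternating_orientation C (\<lambda>_. False) (\<lambda>_ _. False)"
    using assms by (auto simp: isolated_vertex_def alternating_orientation_def)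
  then show ?thesis
    by blast
qed

lemma connectivity_edge:
  assumes "is_graph U" "{x, y} \<in> edges U"
  shows "connectivity U `` {x} = connectivity U `` {y}"
proof -
  let ?R = "{(u, v). {u, v} \<in> edges U}"
  have "(x, y) \<in> ?R" "(y, x) \<in> ?R"
    using assms(2) by (simp_all add: insert_commute)
  then have "(x, z) \<in> ?R\<^sup>* \<longleftrightarrow> (y, z) \<in> ?R\<^sup>*" for z
    by (meson converse_rtrancl_into_rtrancl)
  then show ?thesis
    using edges_pairD[OF assms] by (auto simp: connectivity_def)
qed

text \<open>Orientations chosen component by component are glued; both ends of an edge have the same
  component \<open>K x\<close>.\<close>

lemma ex_alternating_orientation:
  assumes U: "is_graph U" and comps: "even_cycles_or_paths U"
  shows "\<exists>(f :: 'a \<Rightarrow> bool) R. (\<forall>x y. {x, y} \<in> edges U \<longrightarrow> f x \<noteq> f y \<and> (R x y \<or> R y x)) \<and>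
    (\<forall>x y z. {x, y} \<in> edges U \<longrightarrow> {x, z} \<in> edges U \<longrightarrow>
      (R x y \<and> R x z \<longrightarrow> y = z) \<and> (R y x \<and> R z x \<longrightarrow> y = z))"
proof -
  have "\<forall>C\<in>components U. \<exists>p. alternating_orientation C (fst p) (snd p)"
    using comps even_cycle_alternating path_alternating isolated_vertex_alternating
    unfolding even_cycles_or_paths_def by (metis fst_conv snd_conv)
  then obtain p where p: "\<And>C. C \<in> components U \<Longrightarrow> alternating_orientation C (fst (p C)) (snd (p C))"
    by metis
  define K where "K x = induced_graph U (connectivity U `` {x})" for x
  define f where "f x = fst (p (K x)) x" for x
  define R where "R x y = snd (p (K x)) x y" for x y
  have nbr: "K y = K x" "y \<in> verts (K x)" "{x, y} \<in> edges (K x)" "x \<in> verts (K x)" if e: "{x, y} \<in> edges U" for x y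
  proof -
    show "K y = K x"
      using connectivity_edge[OF U e] by (simp add: K_def)
    show yK: "y \<in> verts (K x)"
      using e edges_pairD[OF U e] by (auto simp: K_def induced_graph_def connectivity_def)
    show xK: "x \<in> verts (K x)"
      using edges_pairD[OF U e] by (auto simp: K_def induced_graph_def connectivity_def)
    show "{x, y} \<in> edges (K x)"
      using e xK yK edges_pairD[OF U e] by (simp add: K_def induced_graph_def pair_in_nsets_iff)
  qed
  have alt: "alternating_orientation (K x) (fst (p (K x))) (snd (p (K x)))" if "{x, y} \<in> edges U" for x y
    using edges_pairD(1)[OF U that] by (intro p) (auto simp: K_def components_def quotient_def)
  have "f x \<noteq> f y \<and> (R x y \<or> R y x)" if e: "{x, y} \<in> edges U" for x y
    using alt[OF e] nbr[OF e] unfolding alternating_orientation_def f_def R_def by simp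
  moreover have "(R x y \<and> R x z \<longrightarrow> y = z) \<and> (R y x \<and> R z x \<longrightarrow> y = z)"
    if e: "{x, y} \<in> edges U" "{x, z} \<in> edges U" for x y z
    using alt[OF e(1)] nbr[OF e(1)] nbr[OF e(2)] unfolding alternating_orientation_def f_def R_def
    by (metis (no_types, lifting))
  ultimately show ?thesis
    by (intro exI[of _ f] exI[of _ R]) blast
qed

text \<open>Of two edges at \<open>x\<close>, one leaves and one enters \<open>x\<close>, so their
  tails lie on different sides of \<open>f\<close>. If \<open>{y, z}\<close> is an edge, exactly one
  of \<open>y\<close>, \<open>z\<close> lies on the side of \<open>x\<close>, so \<open>d\<close>
  separates the two non-edges.\<close>

lemma even_cycles_or_paths_imp_bipartite:
  assumes U: "is_graph U" and comps: "even_cycles_or_paths U"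
  shows "bipartite (edge_graph U)" "bipartite (edge_graph (complement_graph U))"
proof -
  obtain f :: "'a \<Rightarrow> bool" and R where f: "\<And>x y. {x, y} \<in> edges U \<Longrightarrow> f x \<noteq> f y \<and> (R x y \<or> R y x)"
    and R: "\<And>x y z. {x, y} \<in> edges U \<Longrightarrow> {x, z} \<in> edges U \<Longrightarrow>
      (R x y \<and> R x z \<longrightarrow> y = z) \<and> (R y x \<and> R z x \<longrightarrow> y = z)"
    using ex_alternating_orientation[OF assms] by blast
  define c where "c e \<longleftrightarrow> (\<exists>x y. e = {x, y} \<and> f x \<and> R x y)" for e
  define d where "d e \<longleftrightarrow> (\<exists>x y. e = {x, y} \<and> f x = f y)" for e
  have c: "c {x, y} \<longleftrightarrow> f x \<and> R x y \<or> f y \<and> R y x" for x y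
    by (auto simp: c_def doubleton_eq_iff)
  have d: "d {x, y} \<longleftrightarrow> f x = f y" for x y
    by (auto simp: d_def doubleton_eq_iff)
  have "c {x, y} \<noteq> c {x, z}" if "y \<noteq> z" "{x, y} \<in> edges U" "{x, z} \<in> edges U" for x y z
    unfolding c using f[OF that(2)] f[OF that(3)] R[OF that(2,3)] that(1) by argo
  then show "bipartite (edge_graph U)"
    unfolding bipartite_edge_graph_iff[OF U] by (intro exI[of _ c]) blast
  have "d {x, y} \<noteq> d {x, z}"
    if "y \<noteq> z" "{x, y} \<in> edges (complement_graph U)" "{x, z} \<in> edges (complement_graph U)"
      "{y, z} \<notin> edges (complement_graph U)" for x y z
  proof -
    have "{y, z} \<in> edges U"
      using that by (auto simp: pair_in_complement_iff)
    then show ?thesis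
      using f d by metis
  qed
  then show "bipartite (edge_graph (complement_graph U))"
    unfolding bipartite_edge_graph_iff[OF is_graph_complement] by (intro exI[of _ d]) blast
qed

section \<open>Induced subgraphs of the grid\<close>

lemma pair_in_P9_iff:
  "{p, q} \<in> edges P9 \<longleftrightarrow> p \<in> verts P9 \<and> q \<in> verts P9 \<and> (fst p = fst q) \<noteq> (snd p = snd q)"
proof
  assume "{p, q} \<in> edges P9"
  then show "p \<in> verts P9 \<and> q \<in> verts P9 \<and> (fst p = fst q) \<noteq> (snd p = snd q)"
    unfolding P9_def by (clarsimp simp: doubleton_eq_iff) (elim disjE; clarsimp)
next
  assume "p \<in> verts P9 \<and> q \<in> verts P9 \<and> (fst p = fst q) \<noteq> (snd p = snd q)"
  then have "{p, q} = {(fst p, snd p), (fst q, snd q)}" "{fst p, snd p, fst q, snd q} \<subseteq> {0, 1, 2}"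
    "(fst p = fst q) \<noteq> (snd p = snd q)"
    unfolding P9_def by auto
  then show "{p, q} \<in> edges P9"
    unfolding P9_def snd_conv by blast
qed

text \<open>Two vertices of the grid are adjacent iff they lie on a line of one of the directions (1,0)
  and (0,1) of the affine plane of order 3, non-adjacent iff they lie on a line of direction (1,1) or
  (1,-1). Both \<open>c\<close> and \<open>d\<close> tell the two directions apart.\<close>

lemma P9_subgraph_imp_bipartite:
  assumes U: "is_graph U" and A: "A \<subseteq> verts P9" and iso: "isomorphic U (induced_graph P9 A)"
  shows "bipartite (edge_graph U)" "bipartite (edge_graph (complement_graph U))"
proof -
  obtain h where h: "bij_betw h (verts U) (verts (induced_graph P9 A))"
    "\<And>x y. x \<in> verts U \<Longrightarrow> y \<in> verts U \<Longrightarrow> {x, y} \<in> edges U \<longleftrightarrow> {h x, h y} \<in> edges (induced_graph P9 A)"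
    using iso by (rule isomorphicE) blast
  have hA: "h x \<in> A" if "x \<in> verts U" for x
    using bij_betwE[OF h(1)] that by (simp add: induced_graph_def)
  define i j where "i x = fst (h x)" and "j x = snd (h x)" for x
  have range: "i x \<in> {0, 1, 2}" "j x \<in> {0, 1, 2}" if "x \<in> verts U" for x
    using hA[OF that] A by (auto simp: P9_def i_def j_def)
  have inj: "i x \<noteq> i y \<or> j x \<noteq> j y" if "x \<in> verts U" "y \<in> verts U" "x \<noteq> y" for x y
    using inj_onD[OF bij_betw_imp_inj_on[OF h(1)], of x y] that by (auto simp: i_def j_def prod_eq_iff)
  have E: "{x, y} \<in> edges U \<longleftrightarrow> (i x = i y) \<noteq> (j x = j y)" if "x \<in> verts U" "y \<in> verts U" for x y
  proof -
    have "{h x, h y} \<in> edges (induced_graph P9 A) \<longleftrightarrow> {h x, h y} \<in> edges P9 \<and> h x \<noteq> h y"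
      using hA that by (simp add: induced_graph_def pair_in_nsets_iff)
    then show ?thesis
      using h(2)[OF that] hA[OF that(1)] hA[OF that(2)] A
      by (auto simp: pair_in_P9_iff i_def j_def prod_eq_iff)
  qed
  define c where "c e \<longleftrightarrow> (\<exists>x y. e = {x, y} \<and> x \<noteq> y \<and> i x = i y)" for e
  \<comment> \<open>The sum of the coordinates modulo 3 is constant exactly along lines of direction
    (1,-1).\<close>
  define d where "d e \<longleftrightarrow> (\<exists>x y. e = {x, y} \<and> x \<noteq> y \<and> (i x + j x) mod 3 = (i y + j y) mod 3)" for e
  have c: "c {x, y} \<longleftrightarrow> i x = i y" if "x \<noteq> y" for x y
    using that by (auto simp: c_def doubleton_eq_iff)
  have d: "d {x, y} \<longleftrightarrow> (i x + j x) mod 3 = (i y + j y) mod 3" if "x \<noteq> y" for x y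
    using that by (auto simp: d_def doubleton_eq_iff)
  \<comment> \<open>If \<open>y\<close> and \<open>z\<close> shared the same coordinate with
    \<open>x\<close>, they would share it with each other and be adjacent.\<close>
  have "c {x, y} \<noteq> c {x, z}"
    if "y \<noteq> z" "{x, y} \<in> edges U" "{x, z} \<in> edges U" "{y, z} \<notin> edges U" for x y z
  proof -
    note V = edges_pairD[OF U that(2)] edges_pairD[OF U that(3)]
    show ?thesis
      unfolding c[OF V(3)] c[OF V(6)]
      using that(2-4) inj[OF V(2,5) that(1)] unfolding E[OF V(1,2)] E[OF V(4,5)] E[OF V(2,5)] by auto
  qed
  then show "bipartite (edge_graph U)"
    unfolding bipartite_edge_graph_iff[OF U] by (intro exI[of _ c]) blast
  have "d {x, y} \<noteq> d {x, z}"
    if "y \<noteq> z" "{x, y} \<in> edges (complement_graph U)" "{x, z} \<in> edges (complement_graph U)"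
      "{y, z} \<notin> edges (complement_graph U)" for x y z
  proof -
    have V: "x \<in> verts U" "y \<in> verts U" "z \<in> verts U" "x \<noteq> y" "x \<noteq> z"
      and ne: "{x, y} \<notin> edges U" "{x, z} \<notin> edges U" "{y, z} \<in> edges U"
      using that by (auto simp: pair_in_complement_iff)
    \<comment> \<open>In the one coordinate where the second and third points differ, their
      differences from the first are the two nonzero residues, so exactly one of the two differences
      of sums vanishes.\<close>
    have grid: "((a + b) mod 3 = (a' + b') mod 3) \<noteq> ((a + b) mod 3 = (a'' + b'') mod 3)"
      if "a \<in> {0, 1, 2}" "b \<in> {0, 1, 2}" "a' \<in> {0, 1, 2}" "b' \<in> {0, 1, 2}" "a'' \<in> {0, 1, 2}" "b'' \<in> {0, 1, 2}"
        "a \<noteq> a'" "b \<noteq> b'" "a \<noteq> a''" "b \<noteq> b''" "(a' = a'') \<noteq> (b' = b'')" for a b a' b' a'' b'' :: nat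
      using that by auto
    show ?thesis
      unfolding d[OF V(4)] d[OF V(5)]
      using ne inj[OF V(1,2,4)] inj[OF V(1,3,5)]
      unfolding E[OF V(1,2)] E[OF V(1,3)] E[OF V(2,3)]
      by (intro grid range V) auto
  qed
  then show "bipartite (edge_graph (complement_graph U))"
    unfolding bipartite_edge_graph_iff[OF is_graph_complement] by (intro exI[of _ d]) blast
qed

subsection \<open>The characterization\<close>

lemma bipartite_imp_structure:
  assumes U: "is_graph U"
    and bip: "bipartite (edge_graph U)" "bipartite (edge_graph (complement_graph U))"
  shows "(\<exists>A. A \<subseteq> verts P9 \<and> isomorphic U (induced_graph P9 A)) \<or>
    even_cycles_or_paths U \<or> even_cycles_or_paths (complement_graph U)"
proof -
  obtain c :: "'a set \<Rightarrow> bool" where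
    c: "\<And>x y z. y \<noteq> z \<Longrightarrow> {x, y} \<in> edges U \<Longrightarrow> {x, z} \<in> edges U \<Longrightarrow>
       {y, z} \<notin> edges U \<Longrightarrow> c {x, y} \<noteq> c {x, z}"
    using bip(1) unfolding bipartite_edge_graph_iff[OF U] by blast
  obtain d :: "'a set \<Rightarrow> bool" where
    d: "\<And>x y z. y \<noteq> z \<Longrightarrow> {x, y} \<in> edges (complement_graph U) \<Longrightarrow> {x, z} \<in> edges (complement_graph U) \<Longrightarrow>
       {y, z} \<notin> edges (complement_graph U) \<Longrightarrow> d {x, y} \<noteq> d {x, z}"
    using bip(2) unfolding bipartite_edge_graph_iff[OF is_graph_complement] by blast
  let ?E = "\<lambda>x y. {x, y} \<in> edges U"
  interpret two_coloured_graph "verts U" ?E "\<lambda>x y. c {x, y}" "\<lambda>x y. d {x, y}"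
  proof
    show "\<not> ?E x x" for x
      using edges_pairD(3)[OF U] by blast
    show "c {x, y} \<noteq> c {x, z}" if "y \<noteq> z" "?E x y" "?E x z" "\<not> ?E y z" for x y z
      using c that by blast
    show "d {x, y} \<noteq> d {x, z}"
      if "x \<in> verts U" "y \<in> verts U" "z \<in> verts U" "x \<noteq> y" "x \<noteq> z" "\<not> ?E x y" "\<not> ?E x z" "?E y z" for x y z
      using that edges_pairD(3)[OF U that(8)] by (intro d) (simp_all add: pair_in_complement_iff)
  qed (simp_all add: insert_commute)
  consider x y z u v w where "triangle x y z" "stable u v w"
    | "\<And>x y z. \<not> triangle x y z" | "\<And>x y z. \<not> stable x y z"
    by blast
  then show ?thesis
  proof cases
    case 1
    then obtain f where "grid_embedding f"
      using ex_grid_embedding by blast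
    then have f: "inj_on f (verts U)" "f ` verts U \<subseteq> verts P9"
      "\<And>x y. x \<in> verts U \<Longrightarrow> y \<in> verts U \<Longrightarrow> x \<noteq> y \<Longrightarrow>
        ?E x y \<longleftrightarrow> (fst (f x) = fst (f y)) \<noteq> (snd (f x) = snd (f y))"
      by (simp_all add: grid_embedding_def P9_def)
    have "isomorphic U (induced_graph P9 (f ` verts U))"
      unfolding isomorphic_def
    proof (intro exI[of _ f] conjI ballI)
      show "bij_betw f (verts U) (verts (induced_graph P9 (f ` verts U)))"
        using f(1) by (simp add: bij_betw_def induced_graph_def)
    next
      fix x y
      assume xy: "x \<in> verts U" "y \<in> verts U"
      show "?E x y \<longleftrightarrow> {f x, f y} \<in> edges (induced_graph P9 (f ` verts U))"
      proof (cases "x = y")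
        case True
        then show ?thesis
          using E_irrefl[of y] by (simp add: induced_graph_def nsets_def)
      next
        case False
        then have "f x \<noteq> f y"
          using f(1) xy by (auto dest: inj_onD)
        then show ?thesis
          using f(3)[OF xy False] f(2) xy
          by (auto simp: induced_graph_def pair_in_nsets_iff pair_in_P9_iff)
      qed
    qed
    then show ?thesis
      using f(2) by blast
  next
    case 2
    interpret edge_coloured_graph U c
    proof
      \<comment> \<open>Without triangles, two neighbours of \<open>x\<close> are never adjacent, so
        \<open>c\<close> separates all edges at \<open>x\<close>.\<close>
      show "c {x, y} \<noteq> c {x, z}" if e: "y \<noteq> z" "?E x y" "?E x z" for x y z
        using 2[of x y z] edges_pairD[OF U e(2)] edges_pairD[OF U e(3)] e
        by (intro c) (auto simp: triangle_def)
    qed (rule U)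
    show ?thesis
      using even_cycles_or_paths by blast
  next
    case 3
    interpret edge_coloured_graph "complement_graph U" d
    proof
      show "d {x, y} \<noteq> d {x, z}"
        if e: "y \<noteq> z" "{x, y} \<in> edges (complement_graph U)" "{x, z} \<in> edges (complement_graph U)" for x y z
        using 3[of x y z] e by (intro d) (auto simp: stable_def pair_in_complement_iff)
    qed (rule is_graph_complement)
    show ?thesis
      using even_cycles_or_paths by blast
  qed
qed

theorem theorem1p2:
  fixes U :: "'a graph"
  assumes "is_graph U"
  shows "((\<exists>G G'. is_graph G \<and> is_graph G' \<and> verts G = verts G' \<and>
              homogeneous_triples G = homogeneous_triples G' \<and> U = boolean_sum G G')
          \<longleftrightarrow>
          (bipartite (edge_graph U) \<and> bipartite (edge_graph (complement_graph U))))
       \<and> ((bipartite (edge_graph U) \<and> bipartite (edge_graph (complement_graph U)))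
          \<longleftrightarrow>
          ((\<exists>A. A \<subseteq> verts P9 \<and> isomorphic U (induced_graph P9 A)) \<or>
           (even_cycles_or_paths U \<or> even_cycles_or_paths (complement_graph U))))"
proof (intro conjI iffI)
  assume "\<exists>G G'. is_graph G \<and> is_graph G' \<and> verts G = verts G' \<and>
    homogeneous_triples G = homogeneous_triples G' \<and> U = boolean_sum G G'"
  then show "bipartite (edge_graph U)" "bipartite (edge_graph (complement_graph U))"
    using homogeneous_triples_imp_bipartite assms by blast+
next
  assume "bipartite (edge_graph U) \<and> bipartite (edge_graph (complement_graph U))"
  then show "\<exists>G G'. is_graph G \<and> is_graph G' \<and> verts G = verts G' \<and>
    homogeneous_triples G = homogeneous_triples G' \<and> U = boolean_sum G G'"
    using bipartite_imp_homogeneous_triples[OF assms] by blast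
next
  assume "bipartite (edge_graph U) \<and> bipartite (edge_graph (complement_graph U))"
  then show "(\<exists>A. A \<subseteq> verts P9 \<and> isomorphic U (induced_graph P9 A)) \<or>
      (even_cycles_or_paths U \<or> even_cycles_or_paths (complement_graph U))"
    using bipartite_imp_structure[OF assms] by blast
next
  assume "(\<exists>A. A \<subseteq> verts P9 \<and> isomorphic U (induced_graph P9 A)) \<or>
    (even_cycles_or_paths U \<or> even_cycles_or_paths (complement_graph U))"
  then show "bipartite (edge_graph U)" "bipartite (edge_graph (complement_graph U))"
    \<comment> \<open>When the complement is the one with cycles and paths, the two bipartiteness
      claims change places, since complementing twice gives back \<open>U\<close>.\<close>
    using P9_subgraph_imp_bipartite[OF assms] even_cycles_or_paths_imp_bipartite[OF assms]
      even_cycles_or_paths_imp_bipartite[OF is_graph_complement, of U] complement_complement[OF assms]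
    by metis+
qed

end
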